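(* Let $k\ge 0$ be an integer and let $r=5+3k$. Then every fullerene nanodisc $D_r$ of radius $r$ is Type~1, i.e. its total chromatic number is $\chi''(D_r)=\Delta(D_r)+1=4$.
   Context: A total coloring of a graph $G=(V,E)$ is an assignment of colors to the elements of $V\cup E$ such that adjacent vertices, adjacent edges, and incident vertex–edge pairs receive different colors. A $k$-total coloring is a total coloring using a set of $k$ colors, and $\chi''(G)$ is the least $k$ for which $G$ has a $k$-total coloring. $G$ is Type~1 if $\chi''(G)=\Delta(G)+1$, where $\Delta(G)$ is the maximum degree. A fullerene graph is a cubic, 3-connected, planar graph all of whose faces are pentagons or hexagons (it then has exactly 12 pentagonal faces). For $r\ge 2$, a fullerene nanodisc $D_r$ of radius $r$ is a fullerene graph with a circular planar embedding whose faces are arranged into $2r+1$ concentric consecutive layers having, in order, $1,6,12,18,\ldots,6(r-1),6r,6(r-1),\ldots,18,12,6,1$ faces, where the first and last layers each consist of one hexagonal face (the covers), and all 12 pentagonal faces lie in the central layer, the unique layer with $6r$ faces (whose other $6r-12$ faces are hexagons). Consecutive layers are separated by $2r$ pairwise vertex-disjoint auxiliary cycles, whose lengths are, in order, $6,18,\ldots,12r-18,12r-6,12r-6,12r-18,\ldots,18,6$; together they contain all $12r^2$ vertices. Each layer other than the covers is the ring of faces between two consecutive auxiliary cycles. The edges of $D_r$ not on auxiliary cycles are the radial edges; each joins two consecutive auxiliary cycles, and the radial edges form a perfect matching of $D_r$. For a given $r$ there may be several nanodiscs, depending on the positions of the pentagons in the central layer. *)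

theory Defs
  imports
    "Graph_Theory.Graph_Theory"
    "HOL-Combinatorics.Orbits"
begin

text \<open>
  A finite simple graph is a \<^locale>\<open>pair_graph\<close>: every undirected edge is represented by its two
  opposite arcs \<open>(u, v)\<close> and \<open>(v, u)\<close>. The out-degree of a vertex is therefore its degree.
\<close>

definition uedges :: "'a pair_pre_digraph \<Rightarrow> 'a set set" where
  "uedges G = {{u, v} | u v. (u, v) \<in> parcs G}"

definition max_degree :: "'a pair_pre_digraph \<Rightarrow> nat" where
  "max_degree G = Max (out_degree (with_proj G) ` pverts G)"

definition cubic :: "'a pair_pre_digraph \<Rightarrow> bool" where
  "cubic G \<longleftrightarrow> (\<forall>v\<in>pverts G. out_degree (with_proj G) v = 3)"

definition k_connected :: "nat \<Rightarrow> 'a pair_pre_digraph \<Rightarrow> bool" where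
  "k_connected k G \<longleftrightarrow> k < card (pverts G) \<and>
     (\<forall>S\<subseteq>pverts G. card S < k \<longrightarrow> Digraph_Component.connected (with_proj G \<restriction> (pverts G - S)))"


section \<open>Total colorings\<close>

definition total_coloring ::
  "'a pair_pre_digraph \<Rightarrow> ('a \<Rightarrow> 'c) \<Rightarrow> ('a set \<Rightarrow> 'c) \<Rightarrow> bool" where
  "total_coloring G cv ce \<longleftrightarrow>
     (\<forall>u v. (u, v) \<in> parcs G \<longrightarrow> cv u \<noteq> cv v) \<and>
     (\<forall>e\<in>uedges G. \<forall>f\<in>uedges G. e \<noteq> f \<and> e \<inter> f \<noteq> {} \<longrightarrow> ce e \<noteq> ce f) \<and>
     (\<forall>e\<in>uedges G. \<forall>v\<in>e. cv v \<noteq> ce e)"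

definition total_colorable :: "'a pair_pre_digraph \<Rightarrow> nat \<Rightarrow> bool" where
  "total_colorable G k \<longleftrightarrow>
     (\<exists>cv ce. total_coloring G cv ce \<and> cv ` pverts G \<subseteq> {..<k} \<and> ce ` uedges G \<subseteq> {..<k})"

definition total_chromatic_number :: "'a pair_pre_digraph \<Rightarrow> nat" where
  "total_chromatic_number G = (LEAST k. total_colorable G k)"

definition type_1 :: "'a pair_pre_digraph \<Rightarrow> bool" where
  "type_1 G \<longleftrightarrow> total_chromatic_number G = max_degree G + 1"


section \<open>Plane embeddings\<close>

text \<open>
  An embedding in an oriented surface is given, up to homeomorphism, by a rotation system: a
  permutation \<open>R\<close> of the arcs that cyclically permutes the arcs leaving each vertex. The face lying
  on a fixed side of an arc \<open>(u, v)\<close> is bounded by its orbit under \<open>(u, v) \<mapsto> R (v, u)\<close>; faces are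
  identified with these orbits, so the cardinality of a face is its length, and the faces on the two
  sides of an edge are those of its two arcs. For connected graphs the surface is the sphere iff
  Euler's formula holds.
\<close>

definition rotation_system :: "'a pair_pre_digraph \<Rightarrow> ('a \<times> 'a \<Rightarrow> 'a \<times> 'a) \<Rightarrow> bool" where
  "rotation_system G R \<longleftrightarrow> R permutes parcs G \<and>
     (\<forall>v\<in>pverts G. out_arcs (with_proj G) v \<noteq> {} \<longrightarrow> cyclic_on R (out_arcs (with_proj G) v))"

definition face_of :: "('a \<times> 'a \<Rightarrow> 'a \<times> 'a) \<Rightarrow> 'a \<times> 'a \<Rightarrow> ('a \<times> 'a) set" where
  "face_of R a = orbit (R \<circ> prod.swap) a"

definition faces :: "'a pair_pre_digraph \<Rightarrow> ('a \<times> 'a \<Rightarrow> 'a \<times> 'a) \<Rightarrow> ('a \<times> 'a) set set" where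
  "faces G R = face_of R ` parcs G"

definition plane_embedding :: "'a pair_pre_digraph \<Rightarrow> ('a \<times> 'a \<Rightarrow> 'a \<times> 'a) \<Rightarrow> bool" where
  "plane_embedding G R \<longleftrightarrow> rotation_system G R \<and> Digraph_Component.connected (with_proj G) \<and>
     card (pverts G) + card (faces G R) = card (uedges G) + 2"


section \<open>Fullerene nanodiscs\<close>

definition fullerene_embedding :: "'a pair_pre_digraph \<Rightarrow> ('a \<times> 'a \<Rightarrow> 'a \<times> 'a) \<Rightarrow> bool" where
  "fullerene_embedding G R \<longleftrightarrow> pair_graph G \<and> cubic G \<and> k_connected 3 G \<and>
     plane_embedding G R \<and> (\<forall>f\<in>faces G R. card f = 5 \<or> card f = 6)"

definition cycle_verts :: "('a \<times> 'a) list \<Rightarrow> 'a set" where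
  "cycle_verts p = fst ` set p"

definition cycle_arcs :: "('a \<times> 'a) list \<Rightarrow> ('a \<times> 'a) set" where
  "cycle_arcs p = set p \<union> prod.swap ` set p"

text \<open>
  \<open>L f\<close> is the index in \<open>{0..2 * r}\<close> of the layer containing the face \<open>f\<close>; the layers \<open>0\<close> and
  \<open>2 * r\<close> are the covers and \<open>r\<close> is the central layer. For \<open>i \<in> {1..2 * r}\<close>, \<open>C i\<close> is the auxiliary
  cycle between the layers \<open>i - 1\<close> and \<open>i\<close>, given as a closed walk in one of its two directions.
  That all pentagons lie in layer \<open>r\<close> forces the covers to be hexagons; that there are \<open>12\<close>
  pentagons follows from Euler's formula.
\<close>

definition nanodisc_layering ::
  "nat \<Rightarrow> 'a pair_pre_digraph \<Rightarrow> ('a \<times> 'a \<Rightarrow> 'a \<times> 'a) \<Rightarrow>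
    (('a \<times> 'a) set \<Rightarrow> nat) \<Rightarrow> (nat \<Rightarrow> ('a \<times> 'a) list) \<Rightarrow> bool" where
  "nanodisc_layering r G R L C \<longleftrightarrow>
     \<comment> \<open>layer sizes \<open>1, 6, 12, \<dots>, 6 (r - 1), 6 r, 6 (r - 1), \<dots>, 12, 6, 1\<close>\<close>
     (\<forall>f\<in>faces G R. L f \<le> 2 * r) \<and>
     (\<forall>i\<le>2 * r. card {f \<in> faces G R. L f = i} =
        (if i = 0 \<or> i = 2 * r then 1 else 6 * min i (2 * r - i))) \<and>
     (\<forall>f\<in>faces G R. card f = 5 \<longrightarrow> L f = r) \<and>
     \<comment> \<open>cycle lengths \<open>6, 18, \<dots>, 12 r - 6, 12 r - 6, \<dots>, 18, 6\<close>\<close>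
     (\<forall>i\<in>{1..2 * r}. pre_digraph.cycle (with_proj G) (C i) \<and>
        length (C i) = 12 * min i (2 * r + 1 - i) - 6) \<and>
     (\<forall>i\<in>{1..2 * r}. \<forall>j\<in>{1..2 * r}. i \<noteq> j \<longrightarrow> cycle_verts (C i) \<inter> cycle_verts (C j) = {}) \<and>
     (\<Union>i\<in>{1..2 * r}. cycle_verts (C i)) = pverts G \<and>
     \<comment> \<open>\<open>C i\<close> consists of exactly the edges between a face of layer \<open>i - 1\<close> and one of layer \<open>i\<close>\<close>
     (\<forall>i\<in>{1..2 * r}. \<forall>a\<in>parcs G. a \<in> cycle_arcs (C i) \<longleftrightarrow>
        {L (face_of R a), L (face_of R (prod.swap a))} = {i - 1, i}) \<and>
     \<comment> \<open>radial edges join consecutive cycles\<close>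
     (\<forall>(u, v)\<in>parcs G - (\<Union>i\<in>{1..2 * r}. cycle_arcs (C i)). \<exists>i\<in>{1..<2 * r}.
        u \<in> cycle_verts (C i) \<and> v \<in> cycle_verts (C (i + 1)) \<or>
        v \<in> cycle_verts (C i) \<and> u \<in> cycle_verts (C (i + 1)))"

definition fullerene_nanodisc :: "nat \<Rightarrow> 'a pair_pre_digraph \<Rightarrow> bool" where
  "fullerene_nanodisc r G \<longleftrightarrow> 2 \<le> r \<and>
     (\<exists>R. fullerene_embedding G R \<and> (\<exists>L C. nanodisc_layering r G R L C))"

end

theory Submission
  imports Defs
begin

text \<open>
  Number the vertices of the auxiliary cycle \<open>C i\<close>, \<open>i \<le> r\<close>, by \<open>n\<close> modulo \<open>6 (2 i - 1)\<close> and write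
  \<open>n = q (2 i - 1) + j\<close>. Following the boundary of the hexagons of layer \<open>i\<close> shows inductively that,
  after a suitable choice of origins, the vertex \<open>(q, j)\<close> of \<open>C i\<close> has its radial edge directed
  outwards iff \<open>j\<close> is even, and this edge ends in the vertex \<open>(q, j + 1)\<close> of \<open>C (i + 1)\<close>. Thus the part
  of the nanodisc on each side of the central layer is unique, and only the twist \<open>e\<close> by which the
  two halves are glued is free.

  All radial edges of the central layer and of its two neighbours receive color \<open>3\<close>. Then \<open>C r\<close> and
  \<open>C (r + 1)\<close> must be colored with period three, in colors \<open>0, 1, 2\<close>. The \<open>t\<close>-th outward vertex of
  \<open>C r\<close> has position \<open>2 t - t div r\<close>, and it is joined to position
  \<open>2 (t + e) - (t + e) div r\<close> of \<open>C (r + 1)\<close>. The difference of these positions takes only two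
  consecutive values, so a suitable shift of the colors of one half makes the colors at the ends of
  all central radial edges different, whatever the twist. If \<open>r mod 3 = 2\<close>, then \<open>2 r - 1\<close> is divisible by
  three, the prescribed colors on \<open>C r\<close> are invariant under the sixfold rotation, and the rest of
  the half can be colored by a pattern that is periodic in \<open>i mod 3\<close> and \<open>j mod 6\<close> away from
  the corners \<open>j = 0\<close> and \<open>j = 2 i - 2\<close>.
\<close>

section \<open>A periodic coloring of one half\<close>

text \<open>
  The colors of the vertex \<open>(q, j)\<close> of \<open>C i\<close>, of the edge to its successor on \<open>C i\<close>, and (for even \<open>j\<close>)
  of its radial edge; \<open>b\<close> stands for \<open>even q\<close>, on which only the two innermost cycles
  depend. The tables were found by a computer search; the entries of \<open>rcol\<close> for odd \<open>j\<close> are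
  placeholders.
\<close>

definition vcol :: "nat \<Rightarrow> bool \<Rightarrow> nat \<Rightarrow> nat" where
  "vcol i b j =
     (if i = 1 then (if b then 2 else 0)
      else if i = 2 then (if b then [3,1,0] else [3,1,2]) ! j
      else if j + 2 = 2 * i then [0,2,0] ! (i mod 3)
      else if j + 3 = 2 * i then [3,3,1] ! (i mod 3)
      else if j = 0 \<and> i mod 3 = 2 then 2
      else [[1,0,1,2,1,0],[0,3,2,3,0,3],[3,1,3,1,3,1]] ! (i mod 3) ! (j mod 6))"

definition ecol :: "nat \<Rightarrow> bool \<Rightarrow> nat \<Rightarrow> nat" where
  "ecol i b j =
     (if i = 1 then (if b then 1 else 3)
      else if i = 2 then (if b then [2,3,2] else [0,3,0]) ! j
      else if j + 2 = 2 * i then [3,1,3] ! (i mod 3)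
      else if j + 3 = 2 * i then [2,0,2] ! (i mod 3)
      else [[2,3,0,3,2,3],[2,1,0,1,2,1],[0,2,0,2,0,2]] ! (i mod 3) ! (j mod 6))"

definition rcol :: "nat \<Rightarrow> bool \<Rightarrow> nat \<Rightarrow> nat" where
  "rcol i b j =
     (if i = 1 then (if b then 0 else 2)
      else if i mod 3 = 0 then (if j + 2 = 2 * i then 1 else [0,0,2,0,0,0] ! (j mod 6))
      else [0,3,1] ! (i mod 3))"

lemmas col_defs = vcol_def ecol_def rcol_def

section \<open>Evaluation of the tables by residues, and the local conditions they satisfy\<close>

lemma mod3_cases: obtains "(i::nat) mod 3 = 0" | "i mod 3 = 1" | "i mod 3 = 2"
  by linarith

lemma mod6_cases:
  fixes j :: nat
  obtains "j mod 6 = 0" "even j" | "j mod 6 = 1" "odd j" | "j mod 6 = 2" "even j"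
   | "j mod 6 = 3" "odd j" | "j mod 6 = 4" "even j" | "j mod 6 = 5" "odd j"
proof -
  have "even j \<and> (j mod 6 = 0 \<or> j mod 6 = 2 \<or> j mod 6 = 4) \<or> odd j \<and> (j mod 6 = 1 \<or> j mod 6 = 3 \<or> j mod 6 = 5)"
    by presburger
  then show ?thesis by (elim disjE conjE) (simp_all add: that)
qed

lemma row_index_cases:
  assumes "1 \<le> (i::nat)" obtains "i = 1" | "i = 2" | "3 \<le> i"
  using assms by linarith

text \<open>Apart from one corner entry, only the residues of \<open>i\<close> and \<open>j\<close>
  enter here, so finitely many cases settle a local condition for all rows at once.
  \<open>col_penultimate\<close> and \<open>col_last\<close> treat the two columns at the end of a
  sector.\<close>

lemma vcol_inner:
  "3 \<le> i \<Longrightarrow> j + 3 < 2 * i \<Longrightarrow> vcol i b j =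
    (if j = 0 \<and> i mod 3 = 2 then 2
     else [[1,0,1,2,1,0],[0,3,2,3,0,3],[3,1,3,1,3,1]] ! (i mod 3) ! (j mod 6))"
  by (simp add: vcol_def)

lemma ecol_inner:
  "3 \<le> i \<Longrightarrow> j + 3 < 2 * i \<Longrightarrow> ecol i b j =
    [[2,3,0,3,2,3],[2,1,0,1,2,1],[0,2,0,2,0,2]] ! (i mod 3) ! (j mod 6)"
  by (simp add: ecol_def)

lemma rcol_inner:
  "3 \<le> i \<Longrightarrow> j + 2 < 2 * i \<Longrightarrow> rcol i b j =
    (if i mod 3 = 0 then [0,0,2,0,0,0] ! (j mod 6) else [0,3,1] ! (i mod 3))"
  by (simp add: rcol_def)

lemma col_penultimate:
  assumes "3 \<le> i" "j + 3 = 2 * i"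
  shows "vcol i b j = [3,3,1] ! (i mod 3)" "ecol i b j = [2,0,2] ! (i mod 3)"
  using assms by (simp_all add: col_defs)

lemma col_last:
  assumes "3 \<le> i" "j + 2 = 2 * i"
  shows "vcol i b j = [0,2,0] ! (i mod 3)" "ecol i b j = [3,1,3] ! (i mod 3)"
    "rcol i b j = [1,3,1] ! (i mod 3)"
  using assms by (simp_all add: col_defs nth_Cons')

lemmas col_eval = vcol_inner ecol_inner rcol_inner col_penultimate col_last

text \<open>The residue of \<open>2 * i - 2\<close> modulo \<open>6\<close> depends only on
  \<open>i mod 3\<close>, which ties the column to the row at the end of a sector.\<close>

lemma mod_last:
  fixes i j :: nat
  assumes "j + 2 = 2 * i"
  shows "i mod 3 = 0 \<Longrightarrow> j mod 6 = 4" "i mod 3 = 1 \<Longrightarrow> j mod 6 = 0" "i mod 3 = 2 \<Longrightarrow> j mod 6 = 2"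
  using assms by presburger+

text \<open>The predecessor of offset \<open>0\<close> is the last offset \<open>2 * i - 2\<close>
  of the preceding sector, whose parity is opposite; hence \<open>\<not> b\<close> for that
  edge.\<close>

lemma vertex_colors_0:
  assumes "1 \<le> i"
  shows "distinct [vcol i b 0, ecol i b 0, ecol i (\<not> b) (2 * i - 2), rcol i b 0]"
  using assms
proof (cases i rule: row_index_cases)
  case 3
  show ?thesis using 3
    by (cases i rule: mod3_cases) (simp_all add: col_eval)
qed (auto simp: col_defs)

text \<open>At the odd offset \<open>Suc j\<close> the radial edge points inwards and comes from
  offset \<open>j\<close> of the previous cycle, so its color is looked up in row
  \<open>i - 1\<close>.\<close>

lemma vertex_colors_odd:
  assumes "2 \<le> i" "j + 3 \<le> 2 * i" "even j"
  shows "distinct [vcol i b (Suc j), ecol i b (Suc j), ecol i b j, rcol (i - 1) b j]"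
proof (cases "i = 2")
  case True
  then have "j = 0" using assms by (auto simp: even_iff_mod_2_eq_zero)
  then show ?thesis using True by (auto simp: col_defs)
next
  case False
  with assms obtain k where k: "i = Suc k" "2 \<le> k" by (cases i) auto
  show ?thesis
  \<comment> \<open>For \<open>i = 3\<close> the inward edge takes its color from row
    \<open>2\<close>, outside the range of \<open>rcol_inner\<close>.\<close>
  proof (cases "k = 2")
    case True
    with assms k have "j = 0 \<or> j = 2" by presburger
    then show ?thesis using k True by (auto simp: col_defs)
  next
    case k3: False
    show ?thesis
    proof (cases "j + 4 = 2 * i")
      case True
      then have "j + 2 = 2 * k" using k by simp
      from mod_last[OF this] show ?thesis using k k3 True
        by (cases k rule: mod3_cases) (simp_all add: col_eval mod_Suc)
    next
      case False
      with assms k have "j + 4 < 2 * i" by presburger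
      with assms(3) k k3 show ?thesis
        by (cases k rule: mod3_cases; cases j rule: mod6_cases) (simp_all add: col_eval mod_Suc)
    qed
  qed
qed

lemma vertex_colors_even:
  assumes "2 \<le> i" "j + 3 \<le> 2 * i" "odd j"
  shows "distinct [vcol i b (Suc j), ecol i b (Suc j), ecol i b j, rcol i b (Suc j)]"
proof (cases "i = 2")
  case True
  then have "j = 1" using assms by presburger
  then show ?thesis using True by (auto simp: col_defs)
next
  case False
  then have i: "3 \<le> i" using assms by simp
  show ?thesis
  proof (cases "j + 3 = 2 * i")
    case True
    then have "Suc j + 2 = 2 * i" by simp
    from mod_last[OF this] show ?thesis using i True
      by (cases i rule: mod3_cases) (simp_all add: col_eval)
  next
    case False
    with assms have "j + 4 < 2 * i" by presburger
    with assms(3) i show ?thesis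
      by (cases i rule: mod3_cases; cases j rule: mod6_cases) (simp_all add: col_eval mod_Suc)
  qed
qed

lemma cycle_adjacent:
  assumes "2 \<le> i" "j + 3 \<le> 2 * i"
  shows "vcol i b j \<noteq> vcol i b (Suc j)"
proof (cases "i = 2")
  case True
  then have "j = 0 \<or> j = 1" using assms by auto
  then show ?thesis using True by (auto simp: col_defs)
next
  case False
  then have i: "3 \<le> i" using assms by simp
  consider "j + 3 = 2 * i" | "j + 4 = 2 * i" | "j + 4 < 2 * i" using assms by linarith
  then show ?thesis
  proof cases
    case 1
    show ?thesis using i 1 by (cases i rule: mod3_cases) (simp_all add: col_eval)
  next
    case 2
    then have "Suc (Suc j) + 2 = 2 * i" by simp
    from mod_last[OF this] 2 i show ?thesis
      by (cases i rule: mod3_cases; cases j rule: mod6_cases) (simp_all add: col_eval mod_Suc)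
  next
    case 3
    with i show ?thesis
      by (cases i rule: mod3_cases; cases j rule: mod6_cases) (auto simp add: col_eval mod_Suc)
  qed
qed

lemma cycle_adjacent_corner:
  assumes "1 \<le> i"
  shows "vcol i b (2 * i - 2) \<noteq> vcol i (\<not> b) 0"
  using assms
proof (cases i rule: row_index_cases)
  case 3
  then show ?thesis by (cases i rule: mod3_cases) (simp_all add: col_eval)
qed (auto simp: col_defs)

lemma radial_adjacent:
  assumes "1 \<le> i" "j + 2 \<le> 2 * i" "even j"
  shows "vcol i b j \<noteq> vcol (Suc i) b (Suc j)"
  using assms(1)
proof (cases i rule: row_index_cases)
  case 1
  with assms show ?thesis by (auto simp: col_defs)
next
  case 2
  with assms have "j = 0 \<or> j = 2" by presburger
  with 2 show ?thesis by (auto simp: col_defs)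
next
  case 3
  show ?thesis
  proof (cases "j + 2 = 2 * i")
    case True
    with 3 show ?thesis by (cases i rule: mod3_cases) (simp_all add: col_eval mod_Suc)
  next
    case False
    with assms have "j + 3 < 2 * i" by presburger
    with 3 assms show ?thesis
      by (cases i rule: mod3_cases; cases j rule: mod6_cases) (auto simp add: col_eval mod_Suc)
  qed
qed

lemma mod3_of_mod6: "(j::nat) mod 3 = (j mod 6) mod 3"
  by (simp add: mod_mod_cancel)

text \<open>To be applied to \<open>i = r - 1\<close> when \<open>r mod 3 = 2\<close>: the outward
  edges carry the color \<open>3\<close> of the central region, and \<open>Suc j mod 3\<close> is
  the color of the other end on \<open>C r\<close>.\<close>

lemma outer_row:
  assumes "3 \<le> i" "i mod 3 = 1" "j + 2 \<le> 2 * i" "even j"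
  shows "rcol i b j = 3" "vcol i b j \<noteq> Suc j mod 3"
proof -
  show "rcol i b j = 3" using assms by (simp add: rcol_def)
  show "vcol i b j \<noteq> Suc j mod 3"
  proof (cases "j + 2 = 2 * i")
    case True
    from mod_last[OF this] True assms show ?thesis
      using mod3_of_mod6[of "Suc j"] by (auto simp: col_eval mod_Suc)
  next
    case False
    with assms have "j + 3 < 2 * i" by presburger
    with assms show ?thesis
      using mod3_of_mod6[of "Suc j"] by (cases j rule: mod6_cases) (auto simp: col_eval mod_Suc)
  qed
qed

lemma col_bounds:
  assumes "1 \<le> i" "j + 2 \<le> 2 * i"
  shows "vcol i b j < 4" "ecol i b j < 4" "rcol i b j < 4"
proof -
  consider "i = 1" "j = 0" | "i = 2" "j = 0 \<or> j = 1 \<or> j = 2" | "3 \<le> i" "j + 2 = 2 * i"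
     | "3 \<le> i" "j + 3 = 2 * i" | "3 \<le> i" "j + 3 < 2 * i" using assms by linarith
  then have "vcol i b j < 4 \<and> ecol i b j < 4 \<and> rcol i b j < 4"
  proof cases
    case 4
    then show ?thesis
      by (cases i rule: mod3_cases; cases j rule: mod6_cases) (auto simp: col_eval mod_Suc)
  next
    case 5
    then show ?thesis
      by (cases i rule: mod3_cases; cases j rule: mod6_cases) (auto simp: col_eval mod_Suc)
  next
    case 3
    then show ?thesis
      by (cases i rule: mod3_cases) (auto simp: col_eval mod_Suc)
  qed (auto simp: col_defs)
  then show "vcol i b j < 4" "ecol i b j < 4" "rcol i b j < 4" by auto
qed

section \<open>Orbits and cycles\<close>

text \<open>Extended by the identity outside \<open>A\<close>, \<open>f\<close> becomes a
  permutation of a finite set, and the orbit of \<open>x\<close> is unchanged. The extension serves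
  the face map, since swapping also moves pairs that are not arcs.\<close>

lemma self_in_orbit_of_inj:
  assumes "finite A" "f \<in> A \<rightarrow> A" "inj_on f A" "x \<in> A"
  shows "x \<in> orbit f x"
proof -
  let ?g = "\<lambda>y. if y \<in> A then f y else y"
  have "inj_on ?g A" using assms by (simp add: inj_on_def)
  moreover have "?g ` A \<subseteq> A" using assms by auto
  ultimately have "?g ` A = A" by (intro endo_inj_surj assms(1))
  with \<open>inj_on ?g A\<close> have "bij_betw ?g A A" by (simp add: bij_betw_def)
  then have "?g permutes A" by (rule bij_imp_permutes) auto
  then have "x \<in> orbit ?g x"
    using assms(1) by (auto intro: permutation_self_in_orbit permutes_imp_permutation)
  moreover have "orbit ?g x = orbit f x"
    by (rule orbit_cong0[OF assms(4)]) (use assms in auto)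
  ultimately show ?thesis by simp
qed

text \<open>The iterates up to the first return to \<open>x\<close> list the orbit without
  repetition, so the cardinality is the return time. Hence a boundary walk closes after as many
  steps as the face is long.\<close>

lemma funpow_card_orbit:
  assumes "x \<in> orbit f x"
  shows "(f ^^ card (orbit f x)) x = x"
proof -
  have "card (orbit f x) = funpow_dist1 f x x"
    using orbit_conv_funpow_dist1[OF assms] inj_on_funpow_dist1[OF assms] by (simp add: card_image)
  then show ?thesis using funpow_dist1_prop[OF assms] by simp
qed

text \<open>The third iterate is the identity and there is no fixed point, which leaves the two
  3-cycles. They are the two possible rotations at a cubic vertex.\<close>

lemma cyclic_on_three:
  assumes cyc: "cyclic_on f {a, b, c}" and dist: "distinct [a, b, c]"
  shows "f a = b \<and> f b = c \<and> f c = a \<or> f a = c \<and> f c = b \<and> f b = a"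
proof -
  let ?S = "{a, b, c}"
  have orb: "orbit f s = ?S" if "s \<in> ?S" for s
    using cyc that unfolding cyclic_on_alldef by blast
  have card3: "card ?S = 3" using dist by simp
  have cube: "f (f (f s)) = s" if "s \<in> ?S" for s
  proof -
    have "(f ^^ card (orbit f s)) s = s" using orb that by (intro funpow_card_orbit) auto
    then show ?thesis using orb[OF that] card3 by (simp add: numeral_3_eq_3)
  qed
  have maps: "f s \<in> ?S" if "s \<in> ?S" for s
    using cyc that by (rule cyclic_on_inI)
  have nofix: "f s \<noteq> s" if "s \<in> ?S" for s
  proof
    assume "f s = s"
    then have "orbit f s = {s}" using orbit_altdef_bounded[of 1 f s] by auto
    with orb[OF that] dist show False by auto
  qed
  have two: "f (f s) \<noteq> s" if "s \<in> ?S" for s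
  proof
    assume "f (f s) = s"
    with cube[OF that] have "f s = s" by simp
    with nofix[OF that] show False by simp
  qed
  show ?thesis using maps nofix two dist by (metis cube distinct_length_2_or_more insertE insertI1 insertI2 singletonD)
qed

lemma pcas_consecutive:
  assumes "pcas u p v"
  shows "Suc k < length p \<Longrightarrow> snd (p ! k) = fst (p ! Suc k)" and "p \<noteq> [] \<Longrightarrow> fst (p ! 0) = u \<and> snd (last p) = v"
  using assms
proof (induction p arbitrary: u k)
  case (Cons e p)
  { case 1 then show ?case using Cons.IH(1)[of "k - 1" "snd e"] Cons.IH(2)[of "snd e"]
      by (cases k) auto
  next case 2 then show ?case using Cons.IH(2)[of "snd e"] by (cases p) auto }
qed auto

lemma pawalk_verts_eq: "pcas u p v \<Longrightarrow> pawalk_verts u p = u # map snd p"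
  by (induction p arbitrary: u) auto

text \<open>Indexing by integers instead of list positions makes the cycle periodic in both
  directions, so shifts and reflections of the index cause no wrap-around cases.\<close>

lemma cycle_enum:
  fixes G :: "'a pair_pre_digraph"
  assumes "pre_digraph.cycle (with_proj G) p"
  obtains c :: "int \<Rightarrow> 'a" where "\<And>k. c (k + int (length p)) = c k"
    "inj_on c {0..<int (length p)}" "set p = range (\<lambda>k. (c k, c (k + 1)))"
proof -
  let ?n = "length p" and ?N = "int (length p)"
  from assms obtain u where u: "pcas u p u" "distinct (map snd p)" "p \<noteq> []"
    by (auto simp: pre_digraph.cycle_def pre_digraph.awalk_def cas_with_proj_eq awalk_verts_with_proj_eq pawalk_verts_eq)
  \<comment> \<open>Heads are used because a \<open>cycle\<close> is distinct in its vertices after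
    the initial one; so the arc at index \<open>k\<close> ends in \<open>c k\<close>.\<close>
  define c where "c k = snd (p ! nat (k mod ?N))" for k
  have pos: "0 < ?N" using u by simp
  have nth: "p ! nat ((k + 1) mod ?N) = (c k, c (k + 1))" for k
  proof -
    let ?m = "nat (k mod ?N)"
    have m: "?m < ?n" using pos by (simp add: nat_less_iff)
    have "fst (p ! nat ((k + 1) mod ?N)) = snd (p ! ?m)"
    proof (cases "Suc ?m < ?n")
      case True
      then have "k mod ?N + 1 < ?N" using pos by linarith
      then have "(k + 1) mod ?N = k mod ?N + 1"
        using pos by (metis mod_add_left_eq mod_pos_pos_trivial pos_mod_sign add_nonneg_nonneg zero_le_one)
      then have "nat ((k + 1) mod ?N) = Suc ?m" using pos by (simp add: nat_add_distrib)
      then show ?thesis using pcas_consecutive(1)[OF u(1) True] by simp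
    next
      case False
      with m have "k mod ?N = ?N - 1" using pos pos_mod_sign[OF pos, of k] pos_mod_bound[OF pos, of k] by linarith
      then have "(k + 1) mod ?N = 0" by (metis diff_add_cancel mod_add_left_eq mod_self)
      moreover have "?m = ?n - 1" using \<open>k mod ?N = ?N - 1\<close> by simp
      ultimately show ?thesis using pcas_consecutive(2)[OF u(1,3)] u(3) by (simp add: last_conv_nth)
    qed
    then show ?thesis unfolding c_def by (metis prod.collapse)
  qed
  have "c (k + ?N) = c k" for k by (simp add: c_def)
  moreover have "inj_on c {0..<?N}"
  proof (rule inj_onI)
    fix x y assume *: "x \<in> {0..<?N}" "y \<in> {0..<?N}" "c x = c y"
    then have "map snd p ! nat x = map snd p ! nat y" "nat x < ?n" "nat y < ?n"
      by (auto simp: c_def)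
    then have "nat x = nat y" using u(2) nth_eq_iff_index_eq[of "map snd p" "nat x" "nat y"] by simp
    then show "x = y" using * by auto
  qed
  moreover have "set p = range (\<lambda>k. (c k, c (k + 1)))"
  proof (intro set_eqI iffI)
    fix a assume "a \<in> set p"
    then obtain m where m: "m < ?n" "a = p ! m" by (auto simp: in_set_conv_nth)
    then have "a = (c (int m - 1), c (int m - 1 + 1))" using nth[of "int m - 1"] by simp
    then show "a \<in> range (\<lambda>k. (c k, c (k + 1)))" by blast
  next
    fix a assume "a \<in> range (\<lambda>k. (c k, c (k + 1)))"
    then obtain k where "a = (c k, c (k + 1))" by blast
    then have "a = p ! nat ((k + 1) mod ?N)" using nth by simp
    moreover have "nat ((k + 1) mod ?N) < ?n" using pos by (simp add: nat_less_iff)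
    ultimately show "a \<in> set p" by simp
  qed
  ultimately show ?thesis using that by blast
qed

lemma periodic_eq_iff:
  fixes c :: "int \<Rightarrow> 'a"
  assumes per: "\<And>k. c (k + n) = c k" and inj: "inj_on c {0..<n}" and n: "0 < n"
  shows "c x = c y \<longleftrightarrow> x mod n = y mod n"
proof -
  have mult: "c (k + n * int m) = c k" for k m
  proof (induction m)
    case (Suc m)
    have "c (k + n * int (Suc m)) = c ((k + n * int m) + n)" by (simp add: algebra_simps)
    then show ?case using per Suc by simp
  qed simp
  have red: "c (k mod n) = c k" for k
  proof (cases "0 \<le> k div n")
    case True
    then show ?thesis using mult[of "k mod n" "nat (k div n)"] by (simp add: mult.commute)
  next
    case False
    then show ?thesis using mult[of k "nat (- (k div n))"] by (simp add: minus_mult_div_eq_mod[symmetric])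
  qed
  show ?thesis
  proof
    assume "c x = c y"
    then have "c (x mod n) = c (y mod n)" by (simp add: red)
    then show "x mod n = y mod n" using inj n by (auto dest!: inj_onD)
  next
    assume "x mod n = y mod n"
    then show "c x = c y" by (metis red)
  qed
qed

section \<open>The local structure of a nanodisc\<close>

locale nanodisc =
  fixes r :: nat and G :: "'a pair_pre_digraph" and R :: "'a \<times> 'a \<Rightarrow> 'a \<times> 'a"
    and L :: "('a \<times> 'a) set \<Rightarrow> nat" and C :: "nat \<Rightarrow> ('a \<times> 'a) list"
  assumes fullerene: "fullerene_embedding G R"
    and layering: "nanodisc_layering r G R L C"
    and radius: "2 \<le> r"
begin

abbreviation "V \<equiv> pverts G"
abbreviation "A \<equiv> parcs G"

text \<open>The face permutation: the next arc on the boundary of the same face.\<close>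

definition nxt :: "'a \<times> 'a \<Rightarrow> 'a \<times> 'a" where "nxt = R \<circ> prod.swap"
definition lay :: "'a \<times> 'a \<Rightarrow> nat" where "lay a = L (face_of R a)"
definition CV :: "nat \<Rightarrow> 'a set" where "CV i = cycle_verts (C i)"
definition CA :: "('a \<times> 'a) set" where "CA = (\<Union>i\<in>{1..2 * r}. cycle_arcs (C i))"
definition len :: "nat \<Rightarrow> int" where "len i = int (12 * min i (2 * r + 1 - i) - 6)"

lemma pair_graph: "pair_graph G"
  using fullerene by (simp add: fullerene_embedding_def)

lemma arc_verts: "(u, v) \<in> A \<Longrightarrow> u \<in> V \<and> v \<in> V"
  and arc_sym: "(u, v) \<in> A \<Longrightarrow> (v, u) \<in> A"
  and finite_arcs: "finite A"
proof -
  interpret pair_graph G by (rule pair_graph)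
  show "(u, v) \<in> A \<Longrightarrow> u \<in> V \<and> v \<in> V" using in_arcsD1 in_arcsD2 by blast
  show "(u, v) \<in> A \<Longrightarrow> (v, u) \<in> A" by (rule arcs_symmetric)
  show "finite A" by (rule pair_finite_arcs)
qed

lemma out_arcs_eq: "out_arcs (with_proj G) v = {a \<in> A. fst a = v}"
  by (simp add: out_arcs_def)

lemma card_out: "v \<in> V \<Longrightarrow> card {a \<in> A. fst a = v} = 3"
  using fullerene by (simp add: fullerene_embedding_def cubic_def out_degree_def out_arcs_eq)

lemma R_permutes: "R permutes A"
  and R_cyclic: "v \<in> V \<Longrightarrow> cyclic_on R {a \<in> A. fst a = v}"
proof -
  have rot: "rotation_system G R"
    using fullerene by (simp add: fullerene_embedding_def plane_embedding_def)
  then show "R permutes A" by (simp add: rotation_system_def)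
  assume "v \<in> V"
  moreover have "{a \<in> A. fst a = v} \<noteq> {}" using card_out[OF \<open>v \<in> V\<close>] by (metis card.empty zero_neq_numeral)
  ultimately show "cyclic_on R {a \<in> A. fst a = v}"
    using rot by (simp add: rotation_system_def out_arcs_eq)
qed

lemma nxt_pair: "nxt (u, v) = R (v, u)"
  by (simp add: nxt_def)

lemma nxt_arc: "a \<in> A \<Longrightarrow> nxt a \<in> A"
  using arc_sym R_permutes by (cases a) (simp add: nxt_pair permutes_in_image)

lemma self_in_face: "a \<in> A \<Longrightarrow> a \<in> orbit nxt a"
proof (rule self_in_orbit_of_inj[OF finite_arcs])
  show "nxt \<in> A \<rightarrow> A" using nxt_arc by blast
  show "inj_on nxt A"
    unfolding nxt_def by (intro comp_inj_on inj_on_subset[OF permutes_inj[OF R_permutes]]) auto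
qed

lemma face_of_eq: "face_of R a = orbit nxt a"
  by (simp add: face_of_def nxt_def)

lemma face_card: "a \<in> A \<Longrightarrow> card (face_of R a) = 5 \<or> card (face_of R a) = 6"
  using fullerene by (simp add: fullerene_embedding_def faces_def)

lemma face_closed: "a \<in> A \<Longrightarrow> (nxt ^^ card (face_of R a)) a = a"
  using self_in_face by (simp add: face_of_eq funpow_card_orbit)

lemma lay_nxt: "a \<in> A \<Longrightarrow> lay (nxt a) = lay a"
  using self_in_orbit_step[OF self_in_face] by (simp add: lay_def face_of_eq)

text \<open>A turn by \<open>R\<close> at \<open>u\<close> is a face step from the reversed arc, so
  layers can be propagated around a vertex.\<close>

lemma lay_R: "(u, v) \<in> A \<Longrightarrow> lay (R (u, v)) = lay (v, u)"
  using lay_nxt[of "(v, u)"] arc_sym by (simp add: nxt_pair)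

lemma lay_le: "a \<in> A \<Longrightarrow> lay a \<le> 2 * r"
  using layering by (simp add: nanodisc_layering_def lay_def faces_def)

lemma pentagon_lay: "a \<in> A \<Longrightarrow> card (face_of R a) = 5 \<Longrightarrow> lay a = r"
  using layering by (simp add: nanodisc_layering_def lay_def faces_def)

lemma cycle_C: "i \<in> {1..2 * r} \<Longrightarrow> pre_digraph.cycle (with_proj G) (C i)"
  and len_C: "i \<in> {1..2 * r} \<Longrightarrow> int (length (C i)) = len i"
  using layering unfolding nanodisc_layering_def len_def by simp_all

lemma CV_disjoint: "i \<in> {1..2 * r} \<Longrightarrow> j \<in> {1..2 * r} \<Longrightarrow> v \<in> CV i \<Longrightarrow> v \<in> CV j \<Longrightarrow> i = j"
proof -
  have "\<forall>i\<in>{1..2 * r}. \<forall>j\<in>{1..2 * r}. i \<noteq> j \<longrightarrow> CV i \<inter> CV j = {}"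
    using layering unfolding nanodisc_layering_def CV_def by (elim conjE) assumption
  then show "i \<in> {1..2 * r} \<Longrightarrow> j \<in> {1..2 * r} \<Longrightarrow> v \<in> CV i \<Longrightarrow> v \<in> CV j \<Longrightarrow> i = j" by blast
qed

lemma CV_Union: "(\<Union>i\<in>{1..2 * r}. CV i) = V"
  using layering unfolding nanodisc_layering_def CV_def by (elim conjE) assumption

lemma cycle_arc_iff:
  assumes "i \<in> {1..2 * r}" "a \<in> A"
  shows "a \<in> cycle_arcs (C i) \<longleftrightarrow> {lay a, lay (prod.swap a)} = {i - 1, i}"
proof -
  have "\<forall>i\<in>{1..2 * r}. \<forall>a\<in>A. a \<in> cycle_arcs (C i) \<longleftrightarrow> {lay a, lay (prod.swap a)} = {i - 1, i}"
    using layering unfolding nanodisc_layering_def lay_def by (elim conjE) assumption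
  then show ?thesis using assms by blast
qed

lemma radial:
  assumes "(u, v) \<in> A - CA"
  shows "\<exists>i\<in>{1..<2 * r}. u \<in> CV i \<and> v \<in> CV (i + 1) \<or> v \<in> CV i \<and> u \<in> CV (i + 1)"
proof -
  have "\<forall>(u, v)\<in>A - CA. \<exists>i\<in>{1..<2 * r}. u \<in> CV i \<and> v \<in> CV (i + 1) \<or> v \<in> CV i \<and> u \<in> CV (i + 1)"
    using layering unfolding nanodisc_layering_def CV_def CA_def by (elim conjE) assumption
  then show ?thesis using assms by blast
qed

section \<open>Enumerations of the auxiliary cycles, and the radial matching\<close>

lemma len_pos: "i \<in> {1..2 * r} \<Longrightarrow> 6 \<le> len i"
  by (auto simp: len_def min_def)

text \<open>Origin and direction are still free; they are normalized by \<open>oriented\<close> and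
  \<open>row\<close>.\<close>

definition enum :: "nat \<Rightarrow> (int \<Rightarrow> 'a) \<Rightarrow> bool" where
  "enum i c \<longleftrightarrow> (\<forall>k. c (k + len i) = c k) \<and> inj_on c {0..<len i} \<and> range c = CV i \<and>
     cycle_arcs (C i) = range (\<lambda>k. (c k, c (k + 1))) \<union> range (\<lambda>k. (c (k + 1), c k))"

lemma ex_enum: "i \<in> {1..2 * r} \<Longrightarrow> \<exists>c. enum i c"
proof -
  assume i: "i \<in> {1..2 * r}"
  from cycle_enum[OF cycle_C[OF i]] len_C[OF i] obtain c :: "int \<Rightarrow> 'a" where
    c: "\<And>k. c (k + len i) = c k" "inj_on c {0..<len i}" "set (C i) = range (\<lambda>k. (c k, c (k + 1)))"
    by metis
  moreover have "range (\<lambda>k. fst (c k, c (k + 1))) = range c" by simp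
  ultimately have "enum i c"
    unfolding enum_def CV_def cycle_verts_def cycle_arcs_def c(3) image_image swap_simp
    by simp
  then show ?thesis by blast
qed

context
  fixes i :: nat and c :: "int \<Rightarrow> 'a"
  assumes i: "i \<in> {1..2 * r}" and enum: "enum i c"
begin

lemma enum_eq_iff: "c x = c y \<longleftrightarrow> x mod len i = y mod len i"
  using enum len_pos[OF i] by (intro periodic_eq_iff) (auto simp: enum_def)

lemma enum_CV: "c k \<in> CV i" and enum_V: "c k \<in> V"
proof -
  show "c k \<in> CV i" using enum by (auto simp: enum_def)
  then show "c k \<in> V" using CV_Union i by blast
qed

lemma enum_arc: "(c k, c (k + 1)) \<in> A" "(c (k + 1), c k) \<in> A"
proof -
  have "set (C i) \<subseteq> A" using cycle_C[OF i] by (auto simp: pre_digraph.cycle_def pre_digraph.awalk_def)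
  then have "cycle_arcs (C i) \<subseteq> A" using arc_sym by (auto simp: cycle_arcs_def)
  then show "(c k, c (k + 1)) \<in> A" "(c (k + 1), c k) \<in> A" using enum by (auto simp: enum_def)
qed

lemma enum_arc': "(c k, c (k - 1)) \<in> A" "(c (k - 1), c k) \<in> A"
  using enum_arc[of "k - 1"] by auto

lemma enum_neq: "c (k + 1) \<noteq> c (k - 1)"
proof
  assume "c (k + 1) = c (k - 1)"
  then have "len i dvd (k + 1) - (k - 1)" by (simp add: enum_eq_iff mod_eq_dvd_iff)
  then show False using len_pos[OF i] by (auto dest: zdvd_imp_le)
qed

text \<open>Since the auxiliary cycles are disjoint, the only one through \<open>c k\<close> is
  \<open>C i\<close>, and just two of its arcs leave this vertex.\<close>

lemma CA_from: "(c k, w) \<in> CA \<longleftrightarrow> w = c (k + 1) \<or> w = c (k - 1)"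
proof
  assume "(c k, w) \<in> CA"
  then obtain j where j: "j \<in> {1..2 * r}" "(c k, w) \<in> cycle_arcs (C j)" by (auto simp: CA_def)
  obtain d where d: "enum j d" using ex_enum[OF j(1)] by blast
  then have "c k \<in> CV j" using j(2) by (auto simp: enum_def)
  then have "j = i" using CV_disjoint[OF j(1) i] enum_CV by blast
  then obtain l where "c k = c l \<and> w = c (l + 1) \<or> c k = c (l + 1) \<and> w = c l"
    using j(2) enum by (auto simp: enum_def)
  then show "w = c (k + 1) \<or> w = c (k - 1)"
  proof
    assume *: "c k = c l \<and> w = c (l + 1)"
    then have "c (l + 1) = c (k + 1)" by (metis enum_eq_iff mod_add_cong)
    with * show ?thesis by simp
  next
    assume *: "c k = c (l + 1) \<and> w = c l"
    then have "c l = c (k - 1)" by (metis enum_eq_iff mod_diff_cong add_diff_cancel_right')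
    with * show ?thesis by simp
  qed
next
  have "(c k, c (k + 1)) \<in> cycle_arcs (C i)" "(c k, c (k - 1)) \<in> cycle_arcs (C i)"
    using enum rangeI[of "\<lambda>k. (c (k + 1), c k)" "k - 1"] by (auto simp: enum_def)
  then show "w = c (k + 1) \<or> w = c (k - 1) \<Longrightarrow> (c k, w) \<in> CA"
    using i by (auto simp: CA_def)
qed

text \<open>Two of the three arcs leaving a vertex belong to its auxiliary cycle; exactly one
  remains.\<close>

lemma ex1_radial: "\<exists>!x. (c k, x) \<in> A - CA"
proof -
  let ?S = "{a \<in> A. fst a = c k}"
  let ?T = "{(c k, c (k + 1)), (c k, c (k - 1))}"
  have "?T \<subseteq> ?S" using enum_arc[of k] enum_arc'[of k] by simp
  moreover have "card ?T = 2" using enum_neq[of k] by simp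
  ultimately have "card (?S - ?T) = 1"
    using card_out[OF enum_V[of k]] by (simp add: card_Diff_subset)
  then obtain a where a: "?S - ?T = {a}" by (auto simp: card_1_singleton_iff)
  have iff: "(c k, x) \<in> A - CA \<longleftrightarrow> (c k, x) \<in> ?S - ?T" for x
    by (simp add: CA_from)
  have "a \<in> ?S - ?T" using a by simp
  then obtain y where y: "a = (c k, y)" by (cases a) simp
  show ?thesis unfolding iff a y by simp
qed

end

text \<open>The partner in the perfect matching of radial edges, well defined on \<open>V\<close> by
  \<open>ex1_radial\<close>.\<close>

definition rad :: "'a \<Rightarrow> 'a" where "rad v = (THE x. (v, x) \<in> A - CA)"

lemma V_enum:
  assumes "v \<in> V" obtains i c k where "i \<in> {1..2 * r}" "enum i c" "v = c k"
proof -
  obtain i where i: "i \<in> {1..2 * r}" "v \<in> CV i" using assms CV_Union by blast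
  obtain c where c: "enum i c" using ex_enum[OF i(1)] by blast
  then have "v \<in> range c" using i(2) by (simp add: enum_def)
  then show ?thesis using that i c by blast
qed

lemma rad_iff:
  assumes "v \<in> V" shows "(v, x) \<in> A - CA \<longleftrightarrow> x = rad v"
proof -
  obtain i c k where "i \<in> {1..2 * r}" "enum i c" "v = c k" using V_enum[OF assms] .
  then have "\<exists>!x. (v, x) \<in> A - CA" using ex1_radial by simp
  then show ?thesis unfolding rad_def using theI'[of "\<lambda>x. (v, x) \<in> A - CA"] by blast
qed

lemma rad_arc: "v \<in> V \<Longrightarrow> (v, rad v) \<in> A - CA" "v \<in> V \<Longrightarrow> rad v \<in> V"
  using rad_iff arc_verts by blast+

lemma CA_sym: "(u, v) \<in> CA \<Longrightarrow> (v, u) \<in> CA"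
  by (force simp: CA_def cycle_arcs_def)

lemma rad_rad: assumes "v \<in> V" shows "rad (rad v) = v"
proof -
  have "(v, rad v) \<in> A - CA" using rad_arc(1)[OF assms] .
  then have "(rad v, v) \<in> A - CA" using arc_sym CA_sym by blast
  then show ?thesis using rad_iff[OF rad_arc(2)[OF assms]] by simp
qed

lemma rad_CV: "v \<in> CV i \<Longrightarrow> i \<in> {1..2 * r} \<Longrightarrow> i < 2 * r \<and> rad v \<in> CV (i + 1) \<or> 2 \<le> i \<and> rad v \<in> CV (i - 1)"
proof -
  assume v: "v \<in> CV i" and i: "i \<in> {1..2 * r}"
  then have "v \<in> V" using CV_Union by blast
  from radial[OF rad_arc(1)[OF this]] obtain j where j: "j \<in> {1..<2 * r}"
     "v \<in> CV j \<and> rad v \<in> CV (j + 1) \<or> rad v \<in> CV j \<and> v \<in> CV (j + 1)" by blast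
  then have "i = j \<and> rad v \<in> CV (j + 1) \<or> i = j + 1 \<and> rad v \<in> CV j"
    using CV_disjoint[OF i _ v] by auto
  with j show ?thesis by auto
qed

text \<open>Fixes the direction of traversal. The rotation at a vertex then tells on which side of
  the cycle its radial edge lies.\<close>

definition oriented :: "nat \<Rightarrow> (int \<Rightarrow> 'a) \<Rightarrow> bool" where
  "oriented i c \<longleftrightarrow> enum i c \<and> (\<forall>k. lay (c k, c (k + 1)) = i \<and> lay (c (k + 1), c k) = i - 1)"

lemma rotation:
  assumes i: "i \<in> {1..2 * r}" and c: "enum i c"
  defines "f \<equiv> \<lambda>k. (c k, c (k + 1))" and "b \<equiv> \<lambda>k. (c k, c (k - 1))" and "g \<equiv> \<lambda>k. (c k, rad (c k))"
  shows "R (f k) = b k \<and> R (b k) = g k \<and> R (g k) = f k \<or> R (f k) = g k \<and> R (g k) = b k \<and> R (b k) = f k"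
proof -
  have cV: "c k \<in> V" using enum_V[OF i c] .
  have "c (k + 1) \<noteq> rad (c k)" "c (k - 1) \<noteq> rad (c k)"
    using CA_from[OF i c, of k "rad (c k)"] rad_arc(1)[OF cV] by auto
  then have dist: "distinct [f k, b k, g k]"
    using enum_neq[OF i c, of k] by (simp add: f_def b_def g_def)
  have "{f k, b k, g k} \<subseteq> {a \<in> A. fst a = c k}"
    using enum_arc(1)[OF i c, of k] enum_arc'(1)[OF i c, of k] rad_arc(1)[OF cV]
    by (simp add: f_def b_def g_def)
  moreover have "card {f k, b k, g k} = 3" using dist by simp
  ultimately have "{f k, b k, g k} = {a \<in> A. fst a = c k}"
    using card_out[OF cV] finite_arcs by (intro card_subset_eq) auto
  then have "cyclic_on R {f k, b k, g k}" using R_cyclic[OF cV] by simp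
  then show ?thesis using dist by (rule cyclic_on_three)
qed

lemma enum_lay:
  assumes i: "i \<in> {1..2 * r}" and c: "enum i c"
  shows "{lay (c k, c (k + 1)), lay (c (k + 1), c k)} = {i - 1, i}"
proof -
  have "(c k, c (k + 1)) \<in> cycle_arcs (C i)" using c by (auto simp: enum_def)
  then show ?thesis using cycle_arc_iff[OF i enum_arc(1)[OF i c, of k]] by simp
qed

lemma lay_radial_R:
  "v \<in> V \<Longrightarrow> lay (R (v, rad v)) = lay (rad v, v)"
  using lay_R rad_arc(1) by blast

text \<open>On the side away from the radial edge at \<open>c k\<close>, the two cycle edges are
  consecutive in the rotation and bound the same face. So this side keeps its layer, and by
  \<open>enum_lay\<close> the other side does too.\<close>

lemma enum_lay_step:
  assumes i: "i \<in> {1..2 * r}" and c: "enum i c"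
  shows "lay (c (k - 1), c k) = lay (c k, c (k + 1))"
  using rotation[OF i c, of k]
proof
  assume *: "R (c k, c (k + 1)) = (c k, c (k - 1)) \<and> R (c k, c (k - 1)) = (c k, rad (c k)) \<and>
    R (c k, rad (c k)) = (c k, c (k + 1))"
  have "lay (c k, c (k - 1)) = lay (c (k + 1), c k)"
    using lay_R[OF enum_arc(1)[OF i c, of k]] * by simp
  then show ?thesis
    using enum_lay[OF i c, of k] enum_lay[OF i c, of "k - 1"] i by (auto simp: doubleton_eq_iff)
next
  assume *: "R (c k, c (k + 1)) = (c k, rad (c k)) \<and> R (c k, rad (c k)) = (c k, c (k - 1)) \<and>
    R (c k, c (k - 1)) = (c k, c (k + 1))"
  then show ?thesis using lay_R[OF enum_arc'(1)[OF i c, of k]] by simp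
qed

lemma range_reindex:
  assumes "\<And>k. f (g k) = k"
  shows "range (\<lambda>k. F (f k)) = range F"
proof -
  have "F x = F (f (g x))" for x using assms by simp
  then show ?thesis by blast
qed

lemma enum_reflect:
  assumes i: "i \<in> {1..2 * r}" and c: "enum i c"
  shows "enum i (\<lambda>k. c (s - k))"
proof -
  have "c (s - (k + len i)) = c (s - k)" for k
    using enum_eq_iff[OF i c, of "s - (k + len i)" "s - k"] by (simp add: mod_eq_dvd_iff)
  moreover have "inj_on (\<lambda>k. c (s - k)) {0..<len i}"
  proof (rule inj_onI)
    fix x y assume *: "x \<in> {0..<len i}" "y \<in> {0..<len i}" "c (s - x) = c (s - y)"
    then have "(s - x) mod len i = (s - y) mod len i" using enum_eq_iff[OF i c] by simp
    then have "(s - (s - x)) mod len i = (s - (s - y)) mod len i" by (rule mod_diff_cong[OF refl])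
    then show "x = y" using * by simp
  qed
  moreover have "range (\<lambda>k. c (s - k)) = range c"
    by (rule range_reindex[where g = "\<lambda>k. s - k"]) simp
  moreover have "range (\<lambda>k. (c (s - k), c (s - (k + 1)))) = range (\<lambda>k. (c (k + 1), c k))"
    using range_reindex[where f = "\<lambda>k. s - 1 - k" and g = "\<lambda>k. s - 1 - k" and F = "\<lambda>k. (c (k + 1), c k)"]
    by (simp add: diff_diff_eq add.commute)
  moreover have "range (\<lambda>k. (c (s - (k + 1)), c (s - k))) = range (\<lambda>k. (c k, c (k + 1)))"
    using range_reindex[where f = "\<lambda>k. s - 1 - k" and g = "\<lambda>k. s - 1 - k" and F = "\<lambda>k. (c k, c (k + 1))"]
    by (simp add: diff_diff_eq add.commute)
  ultimately show ?thesis using c by (auto simp: enum_def)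
qed

text \<open>The sides never change along the cycle; if they are exchanged, the enumeration is
  reversed.\<close>

lemma ex_oriented:
  assumes i: "i \<in> {1..2 * r}"
  shows "\<exists>c. oriented i c"
proof -
  obtain c where c: "enum i c" using ex_enum[OF i] by blast
  have const: "lay (c k, c (k + 1)) = lay (c 0, c 1)" for k
  proof (induction k rule: int_induct[of _ 0])
    case (step1 k) then show ?case using enum_lay_step[OF i c, of "k + 1"] by simp
  next
    case (step2 k) then show ?case using enum_lay_step[OF i c, of "k"] by simp
  qed simp
  have pair: "{lay (c k, c (k + 1)), lay (c (k + 1), c k)} = {i - 1, i}" for k
    by (rule enum_lay[OF i c])
  consider "lay (c 0, c 1) = i" | "lay (c 0, c 1) = i - 1" using pair[of 0] by (auto simp: doubleton_eq_iff)
  then show ?thesis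
  proof cases
    case 1
    have "lay (c k, c (k + 1)) = i \<and> lay (c (k + 1), c k) = i - 1" for k
      using const[of k] pair[of k] 1 i by (auto simp: doubleton_eq_iff)
    then have "oriented i c" using c by (simp add: oriented_def)
    then show ?thesis by blast
  next
    case 2
    let ?d = "\<lambda>k. c (- k)"
    have lay_d: "lay (?d k, ?d (k + 1)) = i \<and> lay (?d (k + 1), ?d k) = i - 1" for k
      using const[of "- k - 1"] pair[of "- k - 1"] 2 i by (auto simp: doubleton_eq_iff)
    have "enum i ?d" using enum_reflect[OF i c, of 0] by simp
    then have "oriented i ?d" using lay_d by (simp add: oriented_def)
    then show ?thesis by blast
  qed
qed

lemma orientedD: "oriented i c \<Longrightarrow> enum i c"
  "oriented i c \<Longrightarrow> lay (c k, c (k + 1)) = i" "oriented i c \<Longrightarrow> lay (c (k + 1), c k) = i - 1"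
  "oriented i c \<Longrightarrow> lay (c (k - 1), c k) = i" "oriented i c \<Longrightarrow> lay (c k, c (k - 1)) = i - 1"
proof -
  assume o: "oriented i c"
  from o show "enum i c" "lay (c k, c (k + 1)) = i" "lay (c (k + 1), c k) = i - 1" for k
    by (auto simp: oriented_def)
  from this(2)[of "k - 1"] this(3)[of "k - 1"]
  show "lay (c (k - 1), c k) = i" "lay (c k, c (k - 1)) = i - 1" by auto
qed

text \<open>The two rotations at \<open>c k\<close> are the two sides on which the radial edge can
  lie. Each face at this edge also contains a cycle arc at \<open>c k\<close>, which determines its
  layer.\<close>

lemma oriented_cases:
  assumes i: "i \<in> {1..2 * r}" and c: "oriented i c"
  obtains (up) "R (c k, c (k + 1)) = (c k, c (k - 1))" "R (c k, c (k - 1)) = (c k, rad (c k))"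
      "R (c k, rad (c k)) = (c k, c (k + 1))" "lay (c k, rad (c k)) = i" "lay (rad (c k), c k) = i"
  | (down) "R (c k, c (k + 1)) = (c k, rad (c k))" "R (c k, rad (c k)) = (c k, c (k - 1))"
      "R (c k, c (k - 1)) = (c k, c (k + 1))" "lay (c k, rad (c k)) = i - 1" "lay (rad (c k), c k) = i - 1"
proof -
  note en = orientedD(1)[OF c]
  note lays = lay_R[OF enum_arc(1)[OF i en, of k]] lay_R[OF enum_arc'(1)[OF i en, of k]]
    lay_radial_R[OF enum_V[OF i en, of k]] orientedD(2-)[OF c, of k]
  from rotation[OF i en, of k] show ?thesis
  proof
    assume *: "R (c k, c (k + 1)) = (c k, c (k - 1)) \<and> R (c k, c (k - 1)) = (c k, rad (c k)) \<and>
      R (c k, rad (c k)) = (c k, c (k + 1))"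
    show ?thesis by (rule up) (use * lays in simp_all)
  next
    assume *: "R (c k, c (k + 1)) = (c k, rad (c k)) \<and> R (c k, rad (c k)) = (c k, c (k - 1)) \<and>
      R (c k, c (k - 1)) = (c k, c (k + 1))"
    show ?thesis by (rule down) (use * lays in simp_all)
  qed
qed

lemma lay_radial_CV:
  assumes j: "j \<in> {1..2 * r}" and v: "v \<in> CV j"
  shows "lay (v, rad v) = j - 1 \<or> lay (v, rad v) = j"
proof -
  obtain c where c: "oriented j c" using ex_oriented[OF j] by blast
  then have "v \<in> range c" using v by (simp add: oriented_def enum_def)
  then obtain k where "v = c k" by blast
  then show ?thesis using oriented_cases[OF j c, of k] by auto
qed

text \<open>Seen from \<open>C (i + 1)\<close> the radial edge lies in layer \<open>i\<close> or
  \<open>i + 1\<close>, seen from \<open>C i\<close> in layer \<open>i - 1\<close> or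
  \<open>i\<close>. Only layer \<open>i\<close> is common, and it selects the rotation.\<close>

lemma turn_up:
  assumes i: "i \<in> {1..2 * r}" "i < 2 * r" and c: "oriented i c" and up: "rad (c k) \<in> CV (i + 1)"
  shows "R (c k, c (k + 1)) = (c k, c (k - 1))" "R (c k, c (k - 1)) = (c k, rad (c k))"
      "R (c k, rad (c k)) = (c k, c (k + 1))" "lay (rad (c k), c k) = i"
proof -
  have "c k \<in> V" using enum_V[OF i(1) orientedD(1)[OF c]] .
  then have "lay (rad (c k), c k) \<in> {i, i + 1}"
    using lay_radial_CV[of "i + 1" "rad (c k)"] up i rad_rad by auto
  with i show "R (c k, c (k + 1)) = (c k, c (k - 1))" "R (c k, c (k - 1)) = (c k, rad (c k))"
      "R (c k, rad (c k)) = (c k, c (k + 1))" "lay (rad (c k), c k) = i"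
    by (cases rule: oriented_cases[OF i(1) c, of k]; auto)+
qed

lemma turn_down:
  assumes i: "i \<in> {1..2 * r}" "2 \<le> i" and c: "oriented i c" and down: "rad (c k) \<in> CV (i - 1)"
  shows "R (c k, c (k + 1)) = (c k, rad (c k))" "R (c k, rad (c k)) = (c k, c (k - 1))"
      "R (c k, c (k - 1)) = (c k, c (k + 1))"
proof -
  have "c k \<in> V" using enum_V[OF i(1) orientedD(1)[OF c]] .
  moreover have "i - 1 \<in> {1..2 * r}" using i by auto
  ultimately have "lay (rad (c k), c k) < i"
    using lay_radial_CV[OF _ down] i rad_rad[of "c k"] by fastforce
  with i show "R (c k, c (k + 1)) = (c k, rad (c k))" "R (c k, rad (c k)) = (c k, c (k - 1))"
      "R (c k, c (k - 1)) = (c k, c (k + 1))"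
    by (cases rule: oriented_cases[OF i(1) c, of k]; auto)+
qed

section \<open>Boundary walks of the faces between two consecutive cycles\<close>

lemma nxt_down_arc:
  assumes i: "i \<in> {1..2 * r}" "i < 2 * r" and c: "oriented i c" and up: "rad (c k) \<in> CV (i + 1)"
  shows "nxt (rad (c k), c k) = (c k, c (k + 1))"
  using turn_up(3)[OF i c up] by (simp add: nxt_pair)

lemma nxt_forward:
  assumes i: "i \<in> {1..2 * r}" "i < 2 * r" and c: "oriented i c"
  shows "nxt (c k, c (k + 1)) =
    (if rad (c (k + 1)) \<in> CV (i + 1) then (c (k + 1), rad (c (k + 1))) else (c (k + 1), c (k + 2)))"
proof (cases "rad (c (k + 1)) \<in> CV (i + 1)")
  case True
  then show ?thesis using turn_up(2)[OF i c True] by (simp add: nxt_pair)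
next
  case False
  then have "2 \<le> i" "rad (c (k + 1)) \<in> CV (i - 1)"
    using rad_CV[OF enum_CV[OF i(1) orientedD(1)[OF c], of "k + 1"] i(1)] by auto
  from turn_down(3)[OF i(1) this(1) c this(2)] False show ?thesis by (simp add: nxt_pair add.commute)
qed

lemma nxt_up_arc:
  assumes i: "i \<in> {1..2 * r}" "2 \<le> i" and d: "oriented i d" and down: "rad (d m) \<in> CV (i - 1)"
  shows "nxt (rad (d m), d m) = (d m, d (m - 1))"
  using turn_down(2)[OF i d down] by (simp add: nxt_pair)

lemma nxt_backward:
  assumes i: "i \<in> {1..2 * r}" "2 \<le> i" and d: "oriented i d"
  shows "nxt (d m, d (m - 1)) =
    (if rad (d (m - 1)) \<in> CV (i - 1) then (d (m - 1), rad (d (m - 1))) else (d (m - 1), d (m - 2)))"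
proof (cases "rad (d (m - 1)) \<in> CV (i - 1)")
  case True
  then show ?thesis using turn_down(1)[OF i d True] by (simp add: nxt_pair)
next
  case False
  then have "i < 2 * r" "rad (d (m - 1)) \<in> CV (i + 1)"
    using rad_CV[OF enum_CV[OF i(1) orientedD(1)[OF d], of "m - 1"] i(1)] by auto
  from turn_up(1)[OF i(1) this(1) d this(2)] False show ?thesis by (simp add: nxt_pair)
qed

text \<open>
  The face containing the radial arc from \<open>d m\<close> down to \<open>c k\<close> runs \<open>g\<close> steps forward along
  \<open>C i\<close>, up a radial edge, and \<open>h\<close> steps backward along \<open>C (i + 1)\<close> to the next radial edge.
  This edge is the initial one: a face with four radial arcs would have length at least eight.
\<close>

lemma ring:
  assumes i: "1 \<le> i" "i < 2 * r" and c: "oriented i c" and d: "oriented (i + 1) d"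
    and km: "rad (c k) = d m"
  obtains g h :: int where "(g, h) \<in> {(1, 2), (1, 3), (2, 1), (2, 2), (3, 1)}"
    "i \<noteq> r \<Longrightarrow> g + h = 4" "rad (c (k + g)) = d (m + h)"
    "\<And>t. 1 \<le> t \<Longrightarrow> t < g \<Longrightarrow> rad (c (k + t)) \<notin> CV (i + 1)"
    "\<And>t. 1 \<le> t \<Longrightarrow> t < h \<Longrightarrow> rad (d (m + t)) \<notin> CV i"
proof -
  have ii: "i \<in> {1..2 * r}" "i + 1 \<in> {1..2 * r}" "2 \<le> i + 1" using i by auto
  define Up where "Up t \<longleftrightarrow> rad (c t) \<in> CV (i + 1)" for t
  define Dn where "Dn t \<longleftrightarrow> rad (d t) \<in> CV i" for t
  \<comment> \<open>The base arc leads from \<open>C (i + 1)\<close> to \<open>C i\<close>. Hence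
    the walk is not closed at an arc starting on \<open>C i\<close> (\<open>nd1\<close>) or lying on
    \<open>C (i + 1)\<close> (\<open>nd2\<close>).\<close>
  define a0 where "a0 = (d m, c k)"
  define e where "e j = (nxt ^^ j) a0" for j
  have c_CV: "c x \<in> CV i" "c x \<in> V" and d_CV: "d x \<in> CV (i + 1)" "d x \<in> V" for x
    using enum_CV[OF ii(1) orientedD(1)[OF c]] enum_V[OF ii(1) orientedD(1)[OF c]]
      enum_CV[OF ii(2) orientedD(1)[OF d]] enum_V[OF ii(2) orientedD(1)[OF d]] by auto
  have cd: "c x \<noteq> d y" for x y
    using CV_disjoint[OF ii(1,2) c_CV(1)[of x]] d_CV(1)[of y] by auto
  have nd1: "(c x, y) \<noteq> a0" and nd2: "(d x, d z) \<noteq> a0" for x y z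
    using cd by (auto simp: a0_def) metis+
  have upk: "rad (c k) \<in> CV (i + 1)" using km d_CV by simp
  have fwd: "nxt (c x, c (x + 1)) = (if Up (x + 1) then (c (x + 1), rad (c (x + 1))) else (c (x + 1), c (x + 2)))" for x
    using nxt_forward[OF ii(1) i(2) c] by (simp add: Up_def)
  have fwd': "nxt (c x, c y) = (if Up y then (c y, rad (c y)) else (c y, c (y + 1)))" if "y = x + 1" for x y
    using fwd[of x] that by (simp add: add.assoc)
  have bwd: "nxt (d x, d (x - 1)) = (if Dn (x - 1) then (d (x - 1), rad (d (x - 1))) else (d (x - 1), d (x - 2)))" for x
    using nxt_backward[OF ii(2,3) d] by (simp add: Dn_def)
  have bwd': "nxt (d x, d y) = (if Dn y then (d y, rad (d y)) else (d y, d (y - 1)))" if "y = x - 1" for x y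
    using bwd[of x] that by simp
  have up: "\<exists>y. rad (c x) = d y \<and> nxt (c x, d y) = (d y, d (y - 1))" if "Up x" for x
  proof -
    have "range d = CV (i + 1)" using orientedD(1)[OF d] by (simp add: enum_def)
    then have "rad (c x) \<in> range d" using that by (simp add: Up_def)
    then obtain y where y: "rad (c x) = d y" by blast
    then have "rad (d y) = c x" using rad_rad[OF c_CV(2), of x] by simp
    with nxt_up_arc[OF ii(2,3) d, of y] y c_CV(1)[of x] show ?thesis by auto
  qed
  have down: "\<exists>x. rad (d y) = c x \<and> nxt (d y, c x) = (c x, c (x + 1))" if "Dn y" for y
  proof -
    have "range c = CV i" using orientedD(1)[OF c] by (simp add: enum_def)
    then have "rad (d y) \<in> range c" using that by (simp add: Dn_def)
    then obtain x where x: "rad (d y) = c x" by blast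
    then have "rad (c x) = d y" using rad_rad[OF d_CV(2), of y] by simp
    with nxt_down_arc[OF ii(1) i(2) c, of x] x d_CV(1)[of y] show ?thesis by auto
  qed
  have a0: "a0 \<in> A" "lay a0 = i"
    using rad_arc(1)[OF c_CV(2), of k] arc_sym km turn_up(4)[OF ii(1) i(2) c upk] by (auto simp: a0_def)
  define N where "N = card (face_of R a0)"
  have N: "N = 5 \<and> e 5 = a0 \<and> i = r \<or> N = 6 \<and> e 6 = a0"
    using face_card[OF a0(1)] face_closed[OF a0(1)] pentagon_lay[OF a0(1)] a0(2) by (auto simp: N_def e_def)
  have e_Suc: "e (Suc j) = nxt (e j)" for j by (simp add: e_def)
  have e1: "e 1 = (c k, c (k + 1))"
    using nxt_down_arc[OF ii(1) i(2) c upk] km by (simp add: e_def a0_def)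
  \<comment> \<open>In each alternative \<open>N = g + h + 2\<close>, the \<open>2\<close> counting
    the radial arcs. The cases follow the walk step by step until it closes.\<close>
  have "\<exists>g h m1. (g, h, N) \<in> {(1, 2, 5), (1, 3, 6), (2, 1, 5), (2, 2, 6), (3, 1, 6)} \<and>
     rad (c (k + g)) = d m1 \<and> d (m1 - h) = d m \<and> (\<forall>t. 1 \<le> t \<and> t < g \<longrightarrow> \<not> Up (k + t)) \<and>
     (\<forall>t. 1 \<le> t \<and> t < h \<longrightarrow> \<not> Dn (m1 - t))"
  proof (cases "Up (k + 1)")
    case u1: True
    then obtain m1 where m1: "rad (c (k + 1)) = d m1" "nxt (c (k + 1), d m1) = (d m1, d (m1 - 1))"
      using up by blast
    have e2: "e 2 = (c (k + 1), d m1)" using e_Suc[of 1] e1 fwd[of k] u1 m1 by (simp add: numeral_2_eq_2)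
    have e3: "e 3 = (d m1, d (m1 - 1))" using e_Suc[of 2] e2 m1 by simp
    show ?thesis
    proof (cases "Dn (m1 - 1)")
      case True
      then obtain k1 where k1: "rad (d (m1 - 1)) = c k1" "nxt (d (m1 - 1), c k1) = (c k1, c (k1 + 1))"
        using down by blast
      have e4: "e 4 = (d (m1 - 1), c k1)" using e_Suc[of 3] e3 bwd[of m1] True k1 by simp
      have e5: "e 5 = (c k1, c (k1 + 1))" using e_Suc[of 4] e4 k1 by simp
      have e6: "fst (e 6) = c (k1 + 1)" using e_Suc[of 5] e5 fwd[of k1] by simp
      \<comment> \<open>Both the fifth and the sixth arc start on \<open>C i\<close>, so the face
        closes neither after five nor after six steps, a contradiction.\<close>
      show ?thesis using N e5 e6 nd1 by (metis prod.collapse)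
    next
      case n1: False
      have e4: "e 4 = (d (m1 - 1), d (m1 - 2))" using e_Suc[of 3] e3 bwd[of m1] n1 by simp
      show ?thesis
      proof (cases "Dn (m1 - 2)")
        case True
        then obtain k1 where k1: "rad (d (m1 - 2)) = c k1" "nxt (d (m1 - 2), c k1) = (c k1, c (k1 + 1))"
          using down by blast
        have e5: "e 5 = (d (m1 - 2), c k1)" using e_Suc[of 4] e4 bwd'[of "m1 - 2" "m1 - 1"] True k1 by simp
        have e6: "e 6 = (c k1, c (k1 + 1))" using e_Suc[of 5] e5 k1 by simp
        then have "N = 5" "e 5 = a0" using N nd1 by metis+
        moreover from this(2) have "d (m1 - 2) = d m" using e5 by (simp add: a0_def)
        moreover have "\<not> Dn (m1 - t)" if "1 \<le> t \<and> t < 2" for t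
        proof -
          have "t = 1" using that by simp
          then show ?thesis using n1 by simp
        qed
        ultimately show ?thesis using m1(1)
          by (intro exI[of _ 1] exI[of _ 2] exI[of _ m1]) auto
      next
        case n2: False
        have e5: "e 5 = (d (m1 - 2), d (m1 - 3))" using e_Suc[of 4] e4 bwd'[of "m1 - 2" "m1 - 1"] n2 by simp
        then have N6: "N = 6" "e 6 = a0" using N nd2 by metis+
        show ?thesis
        proof (cases "Dn (m1 - 3)")
          case True
          have "e 6 = (d (m1 - 3), rad (d (m1 - 3)))" using e_Suc[of 5] e5 bwd'[of "m1 - 3" "m1 - 2"] True by simp
          then have "d (m1 - 3) = d m" using N6 by (simp add: a0_def)
          moreover have "\<not> Dn (m1 - t)" if "1 \<le> t \<and> t < 3" for t
          proof -
            have "t = 1 \<or> t = 2" using that by auto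
            then show ?thesis using n1 n2 by auto
          qed
          ultimately show ?thesis using m1(1) N6
            by (intro exI[of _ 1] exI[of _ 3] exI[of _ m1]) auto
        next
          case False
          then have "e 6 = (d (m1 - 3), d (m1 - 4))" using e_Suc[of 5] e5 bwd'[of "m1 - 3" "m1 - 2"] by simp
          then show ?thesis using N6 nd2 by metis
        qed
      qed
    qed
  next
    case u1: False
    have e2: "e 2 = (c (k + 1), c (k + 2))" using e_Suc[of 1] e1 fwd[of k] u1 by (simp add: numeral_2_eq_2)
    show ?thesis
    proof (cases "Up (k + 2)")
      case u2: True
      then obtain m1 where m1: "rad (c (k + 2)) = d m1" "nxt (c (k + 2), d m1) = (d m1, d (m1 - 1))"
        using up by blast
      have e3: "e 3 = (c (k + 2), d m1)" using e_Suc[of 2] e2 fwd'[of "k + 2" "k + 1"] u2 m1 by (simp add: add.commute)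
      have e4: "e 4 = (d m1, d (m1 - 1))" using e_Suc[of 3] e3 m1 by simp
      have before: "\<not> Up (k + t)" if "1 \<le> t \<and> t < 2" for t
      proof -
        have "t = 1" using that by simp
        then show ?thesis using u1 by simp
      qed
      show ?thesis
      proof (cases "Dn (m1 - 1)")
        case True
        then obtain k1 where k1: "rad (d (m1 - 1)) = c k1" "nxt (d (m1 - 1), c k1) = (c k1, c (k1 + 1))"
          using down by blast
        have e5: "e 5 = (d (m1 - 1), c k1)" using e_Suc[of 4] e4 bwd[of m1] True k1 by simp
        have e6: "e 6 = (c k1, c (k1 + 1))" using e_Suc[of 5] e5 k1 by simp
        then have "N = 5" "e 5 = a0" using N nd1 by metis+
        moreover from this(2) have "d (m1 - 1) = d m" using e5 by (simp add: a0_def)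
        ultimately show ?thesis using m1(1) before
          by (intro exI[of _ 2] exI[of _ 1] exI[of _ m1]) auto
      next
        case n1: False
        have e5: "e 5 = (d (m1 - 1), d (m1 - 2))" using e_Suc[of 4] e4 bwd[of m1] n1 by simp
        then have N6: "N = 6" "e 6 = a0" using N nd2 by metis+
        show ?thesis
        proof (cases "Dn (m1 - 2)")
          case True
          have "e 6 = (d (m1 - 2), rad (d (m1 - 2)))" using e_Suc[of 5] e5 bwd'[of "m1 - 2" "m1 - 1"] True by simp
          then have "d (m1 - 2) = d m" using N6 by (simp add: a0_def)
          moreover have "\<not> Dn (m1 - t)" if "1 \<le> t \<and> t < 2" for t
          proof -
            have "t = 1" using that by simp
            then show ?thesis using n1 by simp
          qed
          ultimately show ?thesis using m1(1) N6 before
            by (intro exI[of _ 2] exI[of _ 2] exI[of _ m1]) auto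
        next
          case False
          then have "e 6 = (d (m1 - 2), d (m1 - 3))" using e_Suc[of 5] e5 bwd'[of "m1 - 2" "m1 - 1"] by simp
          then show ?thesis using N6 nd2 by metis
        qed
      qed
    next
      case u2: False
      have e3: "e 3 = (c (k + 2), c (k + 3))" using e_Suc[of 2] e2 fwd'[of "k + 2" "k + 1"] u2 by (simp add: add.commute)
      show ?thesis
      proof (cases "Up (k + 3)")
        case u3: True
        then obtain m1 where m1: "rad (c (k + 3)) = d m1" "nxt (c (k + 3), d m1) = (d m1, d (m1 - 1))"
          using up by blast
        have e4: "e 4 = (c (k + 3), d m1)" using e_Suc[of 3] e3 fwd'[of "k + 3" "k + 2"] u3 m1 by (simp add: add.commute)
        have e5: "e 5 = (d m1, d (m1 - 1))" using e_Suc[of 4] e4 m1 by simp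
        then have N6: "N = 6" "e 6 = a0" using N nd2 by metis+
        have before: "\<not> Up (k + t)" if "1 \<le> t \<and> t < 3" for t
        proof -
          have "t = 1 \<or> t = 2" using that by auto
          then show ?thesis using u1 u2 by auto
        qed
        show ?thesis
        proof (cases "Dn (m1 - 1)")
          case True
          have "e 6 = (d (m1 - 1), rad (d (m1 - 1)))" using e_Suc[of 5] e5 bwd[of m1] True by simp
          then have "d (m1 - 1) = d m" using N6 by (simp add: a0_def)
          then show ?thesis using m1(1) N6 before
            by (intro exI[of _ 3] exI[of _ 1] exI[of _ m1]) auto
        next
          case False
          then have "e 6 = (d (m1 - 1), d (m1 - 2))" using e_Suc[of 5] e5 bwd[of m1] by simp
          then show ?thesis using N6 nd2 by metis
        qed
      next
        case u3: False
        have e4: "e 4 = (c (k + 3), c (k + 4))" using e_Suc[of 3] e3 fwd'[of "k + 3" "k + 2"] u3 by (simp add: add.commute)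
        show ?thesis
        \<comment> \<open>After four steps along \<open>C i\<close> the walk cannot return to
          \<open>a0\<close> within six arcs.\<close>
        proof (cases "Up (k + 4)")
          case True
          then obtain m1 where m1: "rad (c (k + 4)) = d m1" "nxt (c (k + 4), d m1) = (d m1, d (m1 - 1))"
            using up by blast
          have e5: "e 5 = (c (k + 4), d m1)" using e_Suc[of 4] e4 fwd'[of "k + 4" "k + 3"] True m1 by (simp add: add.commute)
          have e6: "e 6 = (d m1, d (m1 - 1))" using e_Suc[of 5] e5 m1 by simp
          show ?thesis using N e5 e6 nd1 nd2 by metis
        next
          case False
          have e5: "e 5 = (c (k + 4), c (k + 5))" using e_Suc[of 4] e4 fwd'[of "k + 4" "k + 3"] False by (simp add: add.commute)
          have e6: "fst (e 6) = c (k + 5)" using e_Suc[of 5] e5 fwd'[of "k + 5" "k + 4"] by (simp add: add.commute)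
          show ?thesis using N e5 e6 nd1 by (metis prod.collapse)
        qed
      qed
    qed
  qed
  then obtain g h m1 where gh: "(g, h, N) \<in> {(1, 2, 5), (1, 3, 6), (2, 1, 5), (2, 2, 6), (3, 1, 6)}"
     "rad (c (k + g)) = d m1" "d (m1 - h) = d m" "\<And>t. 1 \<le> t \<Longrightarrow> t < g \<Longrightarrow> \<not> Up (k + t)"
     "\<And>t. 1 \<le> t \<Longrightarrow> t < h \<Longrightarrow> \<not> Dn (m1 - t)" by blast
  \<comment> \<open>The walk yields only an equality of vertices; \<open>m1 - h\<close> and
    \<open>m\<close> agree modulo the cycle length, and periodicity carries the statements over to
    \<open>m\<close>.\<close>
  have shift: "d (m1 - h + t) = d (m + t)" for t
  proof -
    have "(m1 - h) mod len (i + 1) = m mod len (i + 1)"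
      using gh(3) enum_eq_iff[OF ii(2) orientedD(1)[OF d]] by simp
    then have "(m1 - h + t) mod len (i + 1) = (m + t) mod len (i + 1)" by (rule mod_add_cong) simp
    then show ?thesis using enum_eq_iff[OF ii(2) orientedD(1)[OF d]] by simp
  qed
  show ?thesis
  proof (rule that)
    show "(g, h) \<in> {(1, 2), (1, 3), (2, 1), (2, 2), (3, 1)}" using gh(1) by auto
    show "i \<noteq> r \<Longrightarrow> g + h = 4" using gh(1) N by auto
    show "rad (c (k + g)) = d (m + h)" using gh(2) shift[of h] by simp
    show "rad (c (k + t)) \<notin> CV (i + 1)" if "1 \<le> t" "t < g" for t
      using gh(4)[OF that] by (simp add: Up_def)
    show "rad (d (m + t)) \<notin> CV i" if "1 \<le> t" "t < h" for t
    proof -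
      have "\<not> Dn (m1 - (h - t))" using gh(5)[of "h - t"] that by simp
      moreover have "d (m1 - (h - t)) = d (m + t)" using shift[of t] by (simp add: algebra_simps)
      ultimately show ?thesis by (simp add: Dn_def)
    qed
  qed
qed

end

section \<open>Coordinates\<close>

text \<open>
  \<open>outpos i t\<close> is the position on \<open>C i\<close> of the \<open>t\<close>-th outward vertex, and \<open>outward i\<close> (below) is
  the map \<open>(q, j) \<mapsto> (q, j + 1)\<close> from positions on \<open>C i\<close> to positions on \<open>C (i + 1)\<close>.
\<close>

definition outpos :: "nat \<Rightarrow> nat \<Rightarrow> int" where
  "outpos i t = 2 * int t - int (t div i)"

text \<open>A sector has the \<open>i\<close> even offsets \<open>0, 2, ..., 2 * i - 2\<close>, so
  index \<open>t\<close> falls into sector \<open>t div i\<close> at offset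
  \<open>2 * (t mod i)\<close>.\<close>

lemma outpos_eq: "outpos i t = int (t div i) * (2 * int i - 1) + 2 * int (t mod i)"
proof -
  have "int t = int (t div i) * int i + int (t mod i)" by (metis div_mult_mod_eq of_nat_add of_nat_mult)
  then show ?thesis unfolding outpos_def by (simp add: algebra_simps)
qed

lemma outpos_divmod:
  assumes "1 \<le> i"
  shows "outpos i t div (2 * int i - 1) = int (t div i)" "outpos i t mod (2 * int i - 1) = 2 * int (t mod i)"
proof -
  have "t mod i < i" using assms by simp
  then have *: "0 \<le> 2 * int (t mod i)" "2 * int (t mod i) < 2 * int i - 1" by linarith+
  show "outpos i t div (2 * int i - 1) = int (t div i)" "outpos i t mod (2 * int i - 1) = 2 * int (t mod i)"
    unfolding outpos_eq using * by simp_all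
qed

text \<open>The gap is one only at a corner, where offset \<open>2 * i - 2\<close> is followed by
  offset \<open>0\<close> of the next sector.\<close>

lemma outpos_Suc:
  assumes "1 \<le> i"
  shows "outpos i (Suc t) = (if Suc (t mod i) = i then outpos i t + 1 else outpos i t + 2)"
  using assms by (simp add: outpos_def div_Suc mod_Suc)

lemma outpos_surj:
  assumes "1 \<le> i" "0 \<le> n" "even (n mod (2 * int i - 1))"
  obtains t where "n = outpos i t"
proof -
  let ?L = "2 * int i - 1"
  have L: "0 < ?L" using assms by simp
  obtain j where j: "n mod ?L = 2 * j" using assms(3) by (elim evenE)
  have "0 \<le> n mod ?L" "n mod ?L < ?L" using L by simp_all
  then have j': "0 \<le> j" "j < int i" using j by linarith+
  have q: "0 \<le> n div ?L" using assms(2) L by (simp add: pos_imp_zdiv_nonneg_iff)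
  let ?t = "nat (n div ?L) * i + nat j"
  have "?t div i = nat (n div ?L)" "?t mod i = nat j" using j' by simp_all
  then have "outpos i ?t = n div ?L * ?L + 2 * j" using q j' by (simp add: outpos_eq)
  then have "n = outpos i ?t" using j by (metis div_mult_mod_eq)
  then show ?thesis by (rule that)
qed

text \<open>Translates a step count \<open>g\<close> found by \<open>ring\<close> into an increment
  of the index of outward vertices.\<close>

lemma outpos_gap:
  assumes i: "1 \<le> i" and X: "\<And>n. X n \<longleftrightarrow> even (n mod (2 * int i - 1))"
  shows "X (outpos i t)"
    and "1 \<le> g \<Longrightarrow> (\<And>s. 1 \<le> s \<Longrightarrow> s < g \<Longrightarrow> \<not> X (outpos i t + s)) \<Longrightarrow> X (outpos i t + g) \<Longrightarrow>
      outpos i (Suc t) = outpos i t + g"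
proof -
  show at: "X (outpos i t)" for t
    using X outpos_divmod(2)[OF i] by simp
  assume g: "1 \<le> g" "\<And>s. 1 \<le> s \<Longrightarrow> s < g \<Longrightarrow> \<not> X (outpos i t + s)" "X (outpos i t + g)"
  show "outpos i (Suc t) = outpos i t + g"
  proof (cases "Suc (t mod i) = i")
    case True
    then have e: "outpos i (Suc t) = outpos i t + 1" using outpos_Suc[OF i] by simp
    then have "\<not> 1 < g" using g(2)[of 1] at[of "Suc t"] by auto
    then show ?thesis using e g(1) by simp
  next
    case False
    then have e: "outpos i (Suc t) = outpos i t + 2" using outpos_Suc[OF i] by simp
    then have "\<not> 2 < g" using g(2)[of 2] at[of "Suc t"] by auto
    moreover have "g \<noteq> 1"
    proof
      assume "g = 1"
      have "t mod i < i" using i by simp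
      then have "Suc (t mod i) < i" using False by linarith
      then have "(2 * int (t mod i) + 1) mod (2 * int i - 1) = 2 * int (t mod i) + 1" by simp
      moreover have "(outpos i t + 1) mod (2 * int i - 1) = (2 * int (t mod i) + 1) mod (2 * int i - 1)"
        using outpos_divmod(2)[OF i, of t] by (metis mod_add_left_eq)
      ultimately show False using g(3) \<open>g = 1\<close> X[of "outpos i t + 1"] by simp
    qed
    ultimately show ?thesis using e g(1) by linarith
  qed
qed

definition outward :: "nat \<Rightarrow> int \<Rightarrow> int" where
  "outward i n = n div (2 * int i - 1) * (2 * int i + 1) + n mod (2 * int i - 1) + 1"

lemma outward_outpos:
  assumes "1 \<le> i" shows "outward i (outpos i t) = outpos i t + 1 + 2 * int (t div i)"
  unfolding outward_def outpos_divmod[OF assms] by (simp add: outpos_eq algebra_simps)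

text \<open>Both cycles consist of six sectors, so full turns correspond and \<open>outward\<close>
  respects periodicity.\<close>

lemma outward_shift:
  "outward i (n + 6 * (2 * int i - 1) * s) = outward i n + 6 * (2 * int i + 1) * s"
proof -
  define d where "d = 2 * int i - 1"
  have "d \<noteq> 0" unfolding d_def by presburger
  have *: "n + 6 * d * s = n + d * (6 * s)" by simp
  have "(n + 6 * d * s) div d = n div d + 6 * s" "(n + 6 * d * s) mod d = n mod d"
    unfolding * using \<open>d \<noteq> 0\<close> by simp_all
  then show ?thesis unfolding outward_def d_def[symmetric] by (simp add: algebra_simps)
qed

section \<open>Inductive numbering of the cycles of one half\<close>

context nanodisc begin

lemma len_upper: "1 \<le> i \<Longrightarrow> i \<le> r \<Longrightarrow> len i = 6 * (2 * int i - 1)"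
  by (auto simp: len_def min_def)

text \<open>A translation is a composition of two reflections, so \<open>enum_reflect\<close>
  applies twice.\<close>

lemma oriented_shift:
  assumes i: "i \<in> {1..2 * r}" and c: "oriented i c"
  shows "oriented i (\<lambda>n. c (s + n))"
proof -
  have "enum i (\<lambda>n. c (s + n))"
    using enum_reflect[OF i enum_reflect[OF i orientedD(1)[OF c], of s], of 0] by simp
  then show ?thesis using orientedD(2,3)[OF c, of "s + _"] by (simp add: oriented_def add.assoc)
qed

text \<open>The origin is now normalized to be the start of a sector.\<close>

definition row :: "nat \<Rightarrow> (int \<Rightarrow> 'a) \<Rightarrow> bool" where
  "row i u \<longleftrightarrow> oriented i u \<and> (\<forall>n. rad (u n) \<in> CV (i + 1) \<longleftrightarrow> even (n mod (2 * int i - 1)))"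

lemma rowD: "row i u \<Longrightarrow> oriented i u" "row i u \<Longrightarrow> rad (u n) \<in> CV (i + 1) \<longleftrightarrow> even (n mod (2 * int i - 1))"
  by (auto simp: row_def)

text \<open>Sectors of \<open>C 1\<close> have length one, and with no cycle further inside every
  radial edge leads outwards.\<close>

lemma row_first: "\<exists>u. row 1 u"
proof -
  have 1: "1 \<in> {1..2 * r}" using radius by simp
  obtain c where c: "oriented 1 c" using ex_oriented[OF 1] by blast
  have "rad (c n) \<in> CV (1 + 1)" for n
    using rad_CV[OF enum_CV[OF 1 orientedD(1)[OF c]] 1, of n] by simp
  then show ?thesis using c by (auto simp: row_def)
qed

text \<open>As layer \<open>i < r\<close> has only hexagons, a gap \<open>g\<close> between outward
  vertices of \<open>C i\<close> faces a gap \<open>4 - g\<close> between their partners: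
  \<open>2\<close> stays \<open>2\<close>, and the corner gap \<open>1\<close> becomes
  \<open>3\<close>. The vertices skipped on \<open>C (i + 1)\<close> are its outward ones, and the
  two skipped in a gap \<open>3\<close> form the next corner.\<close>

lemma row_next:
  assumes i: "1 \<le> i" "i < r" and u: "row i u"
  shows "\<exists>w. row (i + 1) w \<and> (\<forall>n. even (n mod (2 * int i - 1)) \<longrightarrow> rad (u n) = w (outward i n))"
proof -
  have ii: "i \<in> {1..2 * r}" "i + 1 \<in> {1..2 * r}" "i < 2 * r" "i + 1 < 2 * r" "i \<noteq> r" using i by auto
  note ou = rowD(1)[OF u]
  obtain d where d: "oriented (i + 1) d" using ex_oriented[OF ii(2)] by blast
  have "rad (u 0) \<in> CV (i + 1)" using rowD(2)[OF u, of 0] by simp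
  then have "rad (u 0) \<in> range d" using orientedD(1)[OF d] by (simp add: enum_def)
  then obtain m where m: "rad (u 0) = d m" by blast
  \<comment> \<open>The partner of \<open>u 0\<close> gets position \<open>1 = outward i 0\<close>,
    so that position \<open>0\<close> is the second vertex skipped in a gap \<open>3\<close>, where
    a sector begins.\<close>
  define w where "w n = d (m - 1 + n)" for n
  have w: "oriented (i + 1) w" unfolding w_def by (rule oriented_shift[OF ii(2) d])
  \<comment> \<open>This is \<open>outward i (outpos i t)\<close>, the expected position of the
    partner of the outward vertex with index \<open>t\<close>.\<close>
  define Q where "Q t = outpos i t + 1 + 2 * int (t div i)" for t
  have Q_eq: "Q t = int (t div i) * (2 * int i + 1) + 2 * int (t mod i) + 1" for t
    unfolding Q_def by (simp add: outpos_eq algebra_simps)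
  have Q_Suc: "Q (Suc t) = (if Suc (t mod i) = i then Q t + 3 else Q t + 2)" for t
    using outpos_Suc[OF i(1), of t] i(1) by (simp add: Q_def div_Suc mod_Suc)
  have step: "rad (u (outpos i (Suc t))) = w (Q (Suc t)) \<and>
     (\<forall>s. 1 \<le> s \<and> s < Q (Suc t) - Q t \<longrightarrow> rad (w (Q t + s)) \<notin> CV i)"
    if *: "rad (u (outpos i t)) = w (Q t)" for t
  proof -
    from ring[OF i(1) ii(3) ou w *] obtain g h where
      gh: "(g, h) \<in> {(1, 2), (1, 3), (2, 1), (2, 2), (3, 1)}" "g + h = 4"
      "rad (u (outpos i t + g)) = w (Q t + h)"
      "\<And>s. 1 \<le> s \<Longrightarrow> s < g \<Longrightarrow> rad (u (outpos i t + s)) \<notin> CV (i + 1)"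
      "\<And>s. 1 \<le> s \<Longrightarrow> s < h \<Longrightarrow> rad (w (Q t + s)) \<notin> CV i"
      using ii(5) by metis
    have "w (Q t + h) \<in> CV (i + 1)" by (rule enum_CV[OF ii(2) orientedD(1)[OF w]])
    then have "outpos i (Suc t) = outpos i t + g"
      using gh by (intro outpos_gap(2)[OF i(1) rowD(2)[OF u]]) auto
    moreover from this have "Q (Suc t) = Q t + h"
      using Q_Suc[of t] outpos_Suc[OF i(1), of t] gh(2) by (auto split: if_splits)
    ultimately show ?thesis using gh(3,5) by auto
  qed
  have radP: "rad (u (outpos i t)) = w (Q t)" for t
  proof (induction t)
    case 0
    then show ?case using m by (simp add: outpos_def Q_def w_def)
  next
    case (Suc t)
    then show ?case using step by blast
  qed
  have gap: "rad (w (Q t + s)) \<notin> CV i" if "1 \<le> s" "s < Q (Suc t) - Q t" for t s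
    using step[OF radP[of t]] that by blast
  have len_i: "len i = 6 * (2 * int i - 1)" "len (i + 1) = 6 * (2 * int i + 1)"
    using len_upper[of i] len_upper[of "i + 1"] i by auto
  have "rad (u n) = w (outward i n)" if ev: "even (n mod (2 * int i - 1))" for n
  proof -
    \<comment> \<open>Full turns make the position nonnegative, as \<open>outpos_surj\<close>
      requires; \<open>outward_shift\<close> removes them again.\<close>
    define n' where "n' = n + 6 * (2 * int i - 1) * \<bar>n\<bar>"
    have "1 * \<bar>n\<bar> \<le> (6 * (2 * int i - 1)) * \<bar>n\<bar>" using i by (intro mult_right_mono) auto
    then have "0 \<le> n'" unfolding n'_def by linarith
    moreover have n'_mod: "n' mod (2 * int i - 1) = n mod (2 * int i - 1)"
      unfolding n'_def by (metis mod_mult_self2 mult.assoc mult.left_commute)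
    ultimately obtain t where t: "n' = outpos i t" using outpos_surj[OF i(1), of n'] ev by auto
    have "u n = u n'"
      using enum_eq_iff[OF ii(1) orientedD(1)[OF ou], of n n'] by (simp add: n'_def len_i)
    then have "rad (u n) = w (outward i n')"
      using radP[of t] t outward_outpos[OF i(1), of t] by (simp add: Q_def)
    moreover have "w (outward i n') = w (outward i n)"
      unfolding enum_eq_iff[OF ii(2) orientedD(1)[OF w]] n'_def outward_shift len_i(2)
      by (rule mod_mult_self2)
    ultimately show ?thesis by simp
  qed
  moreover have "rad (w n) \<in> CV (i + 1 + 1) \<longleftrightarrow> even (n mod (2 * int (i + 1) - 1))" for n
  proof -
    let ?M = "2 * int i + 1"
    \<comment> \<open>One more turn than before makes \<open>n'\<close> positive: for offset
      \<open>0\<close> the argument looks back into the preceding sector, which calls for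
      \<open>q \<noteq> 0\<close>.\<close>
    define n' where "n' = n + len (i + 1) * (\<bar>n\<bar> + 1)"
    have "1 * (\<bar>n\<bar> + 1) \<le> len (i + 1) * (\<bar>n\<bar> + 1)" unfolding len_i(2) by (intro mult_right_mono) simp_all
    moreover have "- \<bar>n\<bar> \<le> n" by simp
    moreover have "x + y \<ge> 1" if "1 * (z + 1) \<le> y" "- z \<le> x" for x y z :: int using that by simp
    ultimately have n'_pos: "1 \<le> n'" unfolding n'_def by blast
    have n'_mod: "n' mod ?M = n mod ?M"
      unfolding n'_def len_i by (metis mod_mult_self2 mult.assoc mult.left_commute)
    have "w n = w n'"
      unfolding enum_eq_iff[OF ii(2) orientedD(1)[OF w]] n'_def by (rule mod_mult_self2[symmetric])
    define q where "q = nat (n' div ?M)"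
    define j where "j = nat (n' mod ?M)"
    have M: "0 < ?M" by simp
    have q: "int q = n' div ?M" using n'_pos M by (simp add: q_def pos_imp_zdiv_nonneg_iff)
    have j: "int j = n' mod ?M" using M by (simp add: j_def)
    have n'_eq: "n' = int q * ?M + int j" unfolding q j by (rule div_mult_mod_eq[symmetric])
    have j_le: "j \<le> 2 * i" using j pos_mod_bound[OF M, of n'] by linarith
    have odd: "rad (w n') \<in> CV i" if "odd j"
    proof -
      from that obtain l where l: "j = 2 * l + 1" by (elim oddE)
      then have "l < i" using j_le by simp
      then have "n' = Q (q * i + l)" unfolding Q_eq n'_eq using l by simp
      then have "rad (w n') = u (outpos i (q * i + l))"
        using radP rad_rad[OF enum_V[OF ii(1) orientedD(1)[OF ou]]] by metis
      then show ?thesis using enum_CV[OF ii(1) orientedD(1)[OF ou]] by simp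
    qed
    have even: "rad (w n') \<notin> CV i" if "even j"
    \<comment> \<open>Offset \<open>0\<close> is the second vertex skipped after the last partner in
      the preceding sector; every other even offset directly follows a partner.\<close>
    proof (cases "j = 0")
      case True
      then have "q \<noteq> 0" using n'_pos n'_eq by (intro notI) simp
      then obtain p where p: "q = Suc p" by (cases q) auto
      obtain z where z: "z < i" "int z = int i - 1" using i(1) by (intro that[of "i - 1"]) auto
      let ?t = "p * i + z"
      have t: "?t div i = p" "?t mod i = z" using z(1) by simp_all
      then have "n' = Q ?t + 2" unfolding Q_eq t n'_eq z(2) using True p by (simp add: algebra_simps)
      moreover have "Q (Suc ?t) = Q ?t + 3" unfolding Q_Suc t using z by simp
      ultimately show ?thesis using gap[of 2 ?t] by simp
    next
      case False
      with that obtain l where l: "j = 2 * l + 2" by (elim evenE) (metis Suc_pred mult_Suc_right add.commute neq0_conv mult_0_right)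
      then have "l < i" using j_le by simp
      then have "n' = Q (q * i + l) + 1" unfolding Q_eq n'_eq using l by simp
      moreover have "1 < Q (Suc (q * i + l)) - Q (q * i + l)" unfolding Q_Suc by simp
      ultimately show ?thesis using gap[of 1 "q * i + l"] by simp
    qed
    have "rad (w n') \<in> CV i \<longleftrightarrow> odd j" using odd even by blast
    moreover have "rad (w n') \<in> CV (i + 1 + 1) \<longleftrightarrow> rad (w n') \<notin> CV i"
      using rad_CV[OF enum_CV[OF ii(2) orientedD(1)[OF w]] ii(2), of n'] ii
        CV_disjoint[of i "i + 1 + 1" "rad (w n')"] by auto
    moreover have "even j \<longleftrightarrow> even (n' mod ?M)" using j by (metis even_of_nat)
    ultimately show ?thesis using \<open>w n = w n'\<close> n'_mod by (simp add: algebra_simps)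
  qed
  ultimately have "row (i + 1) w" using w by (auto simp: row_def)
  then show ?thesis using \<open>\<And>n. even (n mod (2 * int i - 1)) \<Longrightarrow> rad (u n) = w (outward i n)\<close> by blast
qed

text \<open>Dependent choice is used because the numbering of each cycle determines the origin on
  the next one. The chosen sequence starts at \<open>0\<close>, the cycles at
  \<open>1\<close>.\<close>

lemma rows:
  "\<exists>u. \<forall>i\<in>{1..r}. row i (u i) \<and>
     (i < r \<longrightarrow> (\<forall>n. even (n mod (2 * int i - 1)) \<longrightarrow> rad (u i n) = u (i + 1) (outward i n)))"
proof -
  define Q where "Q i u w \<longleftrightarrow> (i < r \<longrightarrow> (\<forall>n. even (n mod (2 * int i - 1)) \<longrightarrow> rad (u n) = w (outward i n)))"
    for i and u w :: "int \<Rightarrow> 'a"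
  have "\<exists>f. \<forall>n. (Suc n \<le> r \<longrightarrow> row (Suc n) (f n)) \<and> Q (Suc n) (f n) (f (Suc n))"
  proof (rule dependent_nat_choice)
    show "\<exists>u. Suc 0 \<le> r \<longrightarrow> row (Suc 0) u" using row_first by auto
    show "\<exists>w. (Suc (Suc n) \<le> r \<longrightarrow> row (Suc (Suc n)) w) \<and> Q (Suc n) u w"
      if "Suc n \<le> r \<longrightarrow> row (Suc n) u" for u n
      using row_next[of "Suc n" u] that by (cases "Suc n < r") (auto simp: Q_def)
  qed
  then obtain f where f: "\<And>n. (Suc n \<le> r \<longrightarrow> row (Suc n) (f n)) \<and> Q (Suc n) (f n) (f (Suc n))" by blast
  have "row i (f (i - 1)) \<and> Q i (f (i - 1)) (f (i + 1 - 1))" if "i \<in> {1..r}" for i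
    using f[of "i - 1"] that by auto
  then show ?thesis unfolding Q_def by (intro exI[of _ "\<lambda>i. f (i - 1)"]) blast
qed

end

section \<open>Coloring the halves in coordinates\<close>

text \<open>On \<open>C r\<close> the tables give way to period three, which ignores sectors and can
  be matched across the central layer for every twist.\<close>

definition half_vcol :: "nat \<Rightarrow> nat \<Rightarrow> int \<Rightarrow> nat" where
  "half_vcol r i n = (if i = r then nat (n mod 3)
     else vcol i (even (n div (2 * int i - 1))) (nat (n mod (2 * int i - 1))))"

text \<open>On \<open>C r\<close>, the residue of \<open>n + 2\<close> is the one that differs from
  those of both ends \<open>n\<close> and \<open>n + 1\<close>.\<close>

definition half_ecol :: "nat \<Rightarrow> nat \<Rightarrow> int \<Rightarrow> nat" where
  "half_ecol r i n = (if i = r then nat ((n + 2) mod 3)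
     else ecol i (even (n div (2 * int i - 1))) (nat (n mod (2 * int i - 1))))"

text \<open>For an odd offset the edge is the outward edge at offset \<open>j - 1\<close> of the
  previous cycle, where its color is stored.\<close>

definition half_rcol :: "nat \<Rightarrow> nat \<Rightarrow> int \<Rightarrow> nat" where
  "half_rcol r i n = (if i = r then 3
     else let b = even (n div (2 * int i - 1)); j = nat (n mod (2 * int i - 1))
       in if even j then rcol i b j else rcol (i - 1) b (j - 1))"

lemma row_coords:
  assumes "1 \<le> i"
  obtains q :: int and j :: nat where "n = q * (2 * int i - 1) + int j" "j + 2 \<le> 2 * i"
proof (rule that)
  have pos: "0 < 2 * int i - 1" using assms by simp
  show "n = n div (2 * int i - 1) * (2 * int i - 1) + int (nat (n mod (2 * int i - 1)))"
    using pos div_mult_mod_eq[of n "2 * int i - 1"] by (metis int_nat_eq pos_mod_sign)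
  show "nat (n mod (2 * int i - 1)) + 2 \<le> 2 * i"
    using pos_mod_bound[OF pos, of n] pos by linarith
qed

lemma half_coords:
  assumes "j + 2 \<le> 2 * i" and n_def: "n = q * (2 * int i - 1) + int j"
  shows "half_vcol r i n = (if i = r then nat (n mod 3) else vcol i (even q) j)"
    and "half_ecol r i n = (if i = r then nat ((n + 2) mod 3) else ecol i (even q) j)"
    and "half_rcol r i n = (if i = r then 3 else if even j then rcol i (even q) j else rcol (i - 1) (even q) (j - 1))"
proof -
  have "int j < 2 * int i - 1" using assms(1) by linarith
  then have "n div (2 * int i - 1) = q" "n mod (2 * int i - 1) = int j"
    using assms(1) by (simp_all add: n_def)
  then show "half_vcol r i n = (if i = r then nat (n mod 3) else vcol i (even q) j)"
    and "half_ecol r i n = (if i = r then nat ((n + 2) mod 3) else ecol i (even q) j)"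
    and "half_rcol r i n = (if i = r then 3 else if even j then rcol i (even q) j else rcol (i - 1) (even q) (j - 1))"
    by (simp_all add: half_vcol_def half_ecol_def half_rcol_def Let_def)
qed

lemma mod3_shifts:
  fixes n :: int
  shows "distinct [nat (n mod 3), nat ((n + 2) mod 3), nat ((n + 1) mod 3), 3]"
    "nat (n mod 3) \<noteq> nat ((n + 1) mod 3)"
proof -
  have "n mod 3 = 0 \<and> (n + 1) mod 3 = 1 \<and> (n + 2) mod 3 = 2 \<or>
    n mod 3 = 1 \<and> (n + 1) mod 3 = 2 \<and> (n + 2) mod 3 = 0 \<or>
    n mod 3 = 2 \<and> (n + 1) mod 3 = 0 \<and> (n + 2) mod 3 = 1" by presburger
  then show "distinct [nat (n mod 3), nat ((n + 2) mod 3), nat ((n + 1) mod 3), 3]"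
    "nat (n mod 3) \<noteq> nat ((n + 1) mod 3)" by (elim disjE; simp)+
qed

lemma half_vertex:
  assumes i: "1 \<le> i"
  shows "distinct [half_vcol r i n, half_ecol r i n, half_ecol r i (n - 1), half_rcol r i n]"
proof (cases "i = r")
  case True
  then show ?thesis using mod3_shifts(1)[of n] by (simp add: half_vcol_def half_ecol_def half_rcol_def add.commute)
next
  case False
  obtain q j where n: "n = q * (2 * int i - 1) + int j" and j: "j + 2 \<le> 2 * i" using row_coords[OF i] .
  note here = half_coords[OF j n, of r]
  show ?thesis
  proof (cases j)
    case 0
    have eq: "n - 1 = (q - 1) * (2 * int i - 1) + int (2 * i - 2)"
      unfolding n using 0 i by (simp add: algebra_simps of_nat_diff)
    have "half_ecol r i (n - 1) = ecol i (\<not> even q) (2 * i - 2)"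
      using half_coords(2)[OF _ eq, of r] False i by simp
    then show ?thesis using vertex_colors_0[OF i, of "even q"] here False 0 by simp
  next
    case (Suc j')
    have eq: "n - 1 = q * (2 * int i - 1) + int j'" unfolding n using Suc by simp
    have e: "half_ecol r i (n - 1) = ecol i (even q) j'"
      using half_coords(2)[OF _ eq, of r] False j Suc by simp
    have i2: "2 \<le> i" "j' + 3 \<le> 2 * i" using j Suc by linarith+
    show ?thesis
    proof (cases "even j'")
      case True
      then show ?thesis using vertex_colors_odd[OF i2 True, of "even q"] here e False Suc by simp
    next
      case odd: False
      then show ?thesis using vertex_colors_even[OF i2 odd, of "even q"] here e False Suc by simp
    qed
  qed
qed

lemma half_cycle:
  assumes i: "1 \<le> i"
  shows "half_vcol r i n \<noteq> half_vcol r i (n + 1)"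
proof (cases "i = r")
  case True
  then show ?thesis using mod3_shifts(2)[of n] by (simp add: half_vcol_def)
next
  case False
  obtain q j where n: "n = q * (2 * int i - 1) + int j" and j: "j + 2 \<le> 2 * i" using row_coords[OF i] .
  note here = half_coords(1)[OF j n, of r]
  show ?thesis
  proof (cases "j + 2 = 2 * i")
    case True
    have eq: "n + 1 = (q + 1) * (2 * int i - 1) + int 0" unfolding n using True by (simp add: algebra_simps)
    have "half_vcol r i (n + 1) = vcol i (\<not> even q) 0"
      using half_coords(1)[OF _ eq, of r] False i by simp
    moreover have "j = 2 * i - 2" using True by simp
    ultimately show ?thesis using cycle_adjacent_corner[OF i, of "even q"] here False by simp
  next
    case less: False
    have eq: "n + 1 = q * (2 * int i - 1) + int (Suc j)" unfolding n by simp
    have "half_vcol r i (n + 1) = vcol i (even q) (Suc j)"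
      using half_coords(1)[OF _ eq, of r] False j less by simp
    moreover have "2 \<le> i" "j + 3 \<le> 2 * i" using j less by linarith+
    ultimately show ?thesis using cycle_adjacent[of i j "even q"] here False by simp
  qed
qed

text \<open>At the transition \<open>i + 1 = r\<close> the hypothesis on \<open>r mod 3\<close>
  makes \<open>2 * r - 1\<close> divisible by three. The color on \<open>C r\<close> then depends
  only on the offset, and \<open>outer_row\<close> applies.\<close>

lemma half_radial:
  assumes r: "r mod 3 = 2" "5 \<le> r" and i: "1 \<le> i" "i < r" and ev: "even (n mod (2 * int i - 1))"
  shows "half_vcol r i n \<noteq> half_vcol r (i + 1) (outward i n)" "half_rcol r i n = half_rcol r (i + 1) (outward i n)"
proof -
  obtain q j where n: "n = q * (2 * int i - 1) + int j" and j: "j + 2 \<le> 2 * i" using row_coords[OF i(1)] .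
  have "int j < 2 * int i - 1" using j by linarith
  then have qj: "n div (2 * int i - 1) = q" "n mod (2 * int i - 1) = int j"
    using j by (simp_all add: n)
  then have evj: "even j" using ev by simp
  have out: "outward i n = q * (2 * int (i + 1) - 1) + int (Suc j)"
    unfolding outward_def qj by (simp add: algebra_simps)
  have j': "Suc j + 2 \<le> 2 * (i + 1)" using j by simp
  note here = half_coords[OF j n, of r]
  note there = half_coords[OF j' out, of r]
  show "half_vcol r i n \<noteq> half_vcol r (i + 1) (outward i n)"
  proof (cases "i + 1 = r")
    case True
    have i3: "3 \<le> i" "i mod 3 = 1" using True r by presburger+
    have "2 * int (i + 1) - 1 = 3 * ((2 * int (i + 1) - 1) div 3)" using i3(2) by presburger
    then have "outward i n mod 3 = int (Suc j) mod 3"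
      unfolding out by (metis mod_mult_self4 mult.left_commute)
    then have "nat (outward i n mod 3) = Suc j mod 3" by (metis nat_int of_nat_mod of_nat_numeral)
    moreover have "half_vcol r i n = vcol i (even q) j" using here(1) i(2) by simp
    moreover have "half_vcol r (i + 1) (outward i n) = nat (outward i n mod 3)" using there(1) True by simp
    ultimately show ?thesis using outer_row(2)[OF i3 j evj, of "even q"] by metis
  next
    case False
    then show ?thesis using radial_adjacent[OF i(1) j evj, of "even q"] here there i by simp
  qed
  show "half_rcol r i n = half_rcol r (i + 1) (outward i n)"
  proof (cases "i + 1 = r")
    case True
    have i3: "3 \<le> i" "i mod 3 = 1" using True r by presburger+
    then show ?thesis using outer_row(1)[OF i3 j evj, of "even q"] here there True i evj by simp
  next
    case False
    then show ?thesis using here there i evj by simp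
  qed
qed

lemma half_bounds:
  assumes i: "1 \<le> i"
  shows "half_vcol r i n < 4" "half_ecol r i n < 4" "half_rcol r i n < 4"
proof -
  obtain q j where n: "n = q * (2 * int i - 1) + int j" and j: "j + 2 \<le> 2 * i" using row_coords[OF i] .
  note here = half_coords[OF j n, of r]
  have "nat (x mod 3) < 4" for x :: int by (simp add: nat_less_iff pos_mod_bound[THEN less_trans])
  then show "half_vcol r i n < 4" "half_ecol r i n < 4"
    unfolding here(1,2) using col_bounds(1,2)[OF i j, of "even q"] by simp_all
  show "half_rcol r i n < 4"
  proof (cases "even j")
    case False
    then have "1 \<le> i - 1" "(j - 1) + 2 \<le> 2 * (i - 1)" using j by presburger+
    then show ?thesis using here(3) False col_bounds(3)[of "i - 1" "j - 1"] by simp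
  qed (use here(3) col_bounds(3)[OF i j] in auto)
qed

text \<open>The sector enters only through its parity and the position on \<open>C r\<close> only
  modulo three; both are unchanged by a turn of six sectors.\<close>

lemma half_periodic:
  assumes i: "1 \<le> i" and eq: "n mod (6 * (2 * int i - 1)) = n' mod (6 * (2 * int i - 1))"
  shows "half_vcol r i n = half_vcol r i n'" "half_ecol r i n = half_ecol r i n'" "half_rcol r i n = half_rcol r i n'"
proof -
  let ?L = "2 * int i - 1"
  have L: "0 < ?L" using i by simp
  have dm: "m mod ?L = m mod (6 * ?L) mod ?L" for m by (rule mod_mod_cancel[symmetric]) (rule dvd_triv_right)
  have mods: "n mod ?L = n' mod ?L" using eq dm by metis
  have "m mod (?L * 6) = ?L * (m div ?L mod 6) + m mod ?L" for m by (rule zmod_zmult2_eq) simp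
  then have "?L * (n div ?L mod 6) = ?L * (n' div ?L mod 6)"
    using eq mods by (metis add_right_cancel mult.commute)
  then have "n div ?L mod 6 = n' div ?L mod 6" using L by simp
  moreover have "even x \<longleftrightarrow> even y" if "x mod 6 = y mod 6" for x y :: int using that by presburger
  ultimately have par: "even (n div ?L) \<longleftrightarrow> even (n' div ?L)" by blast
  have "m mod 3 = m mod (6 * ?L) mod 3" for m by (rule mod_mod_cancel[symmetric], rule dvd_mult2) simp
  then have "n mod 3 = n' mod 3" using eq by metis
  moreover from this have "(n + 2) mod 3 = (n' + 2) mod 3" by (metis mod_add_left_eq)
  ultimately show "half_vcol r i n = half_vcol r i n'" "half_ecol r i n = half_ecol r i n'" "half_rcol r i n = half_rcol r i n'"
    using mods par by (simp_all add: half_vcol_def half_ecol_def half_rcol_def Let_def)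
qed

section \<open>Total colorings from symmetric arc colorings, and the lower bound for cubic
  graphs\<close>

lemma total_colorable_of_arc_coloring:
  assumes sym: "\<And>u v. (u, v) \<in> parcs G \<Longrightarrow> (v, u) \<in> parcs G \<and> ec u v = ec v u"
    and vv: "\<And>u v. (u, v) \<in> parcs G \<Longrightarrow> vc u \<noteq> vc v \<and> vc u \<noteq> ec u v \<and> ec u v < k"
    and ee: "\<And>u v w. (u, v) \<in> parcs G \<Longrightarrow> (u, w) \<in> parcs G \<Longrightarrow> v \<noteq> w \<Longrightarrow> ec u v \<noteq> ec u w"
    and bound: "\<And>u. u \<in> pverts G \<Longrightarrow> vc u < k"
  shows "total_colorable G k"
proof -
  \<comment> \<open>Symmetry of \<open>ec\<close> makes the choice independent of the order of the
    two ends.\<close>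
  define ce where "ce e = (SOME c. \<exists>u v. (u, v) \<in> parcs G \<and> e = {u, v} \<and> c = ec u v)" for e
  have ce: "ce {u, v} = ec u v" if "(u, v) \<in> parcs G" for u v
    unfolding ce_def
  proof (rule some_equality)
    show "\<exists>a b. (a, b) \<in> parcs G \<and> {u, v} = {a, b} \<and> ec u v = ec a b" using that by blast
    fix c assume "\<exists>a b. (a, b) \<in> parcs G \<and> {u, v} = {a, b} \<and> c = ec a b"
    then show "c = ec u v" using sym that by (auto simp: doubleton_eq_iff)
  qed
  have "ce e \<noteq> ce f" if ef: "e \<in> uedges G" "f \<in> uedges G" "e \<noteq> f" "e \<inter> f \<noteq> {}" for e f
  proof -
    obtain x where x: "x \<in> e" "x \<in> f" using ef(4) by blast
    have other: "\<exists>y. (x, y) \<in> parcs G \<and> h = {x, y}" if "h \<in> uedges G" "x \<in> h" for h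
      using that sym by (auto simp: uedges_def insert_commute)
    obtain y z where "(x, y) \<in> parcs G" "e = {x, y}" "(x, z) \<in> parcs G" "f = {x, z}"
      using other ef x by meson
    then show ?thesis using ee[of x y z] ce ef(3) by auto
  qed
  moreover have "vc x \<noteq> ce e" if "e \<in> uedges G" "x \<in> e" for e x
  proof -
    obtain u v where "(u, v) \<in> parcs G" "e = {u, v}" using \<open>e \<in> uedges G\<close> by (auto simp: uedges_def)
    then show ?thesis using vv[of u v] vv[of v u] sym[of u v] ce \<open>x \<in> e\<close> by auto
  qed
  ultimately have "total_coloring G vc ce"
    using vv by (auto simp: total_coloring_def)
  moreover have "ce ` uedges G \<subseteq> {..<k}" using ce vv by (auto simp: uedges_def)
  moreover have "vc ` pverts G \<subseteq> {..<k}" using bound by auto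
  ultimately show ?thesis unfolding total_colorable_def by blast
qed

text \<open>A vertex and its three incident edges have pairwise different colors.\<close>

lemma total_colorable_lower_bound:
  assumes "pair_graph G" "cubic G" "v \<in> pverts G" "total_colorable G k"
  shows "4 \<le> k"
proof -
  interpret pair_graph G by fact
  obtain vc ce where c: "total_coloring G vc ce" "vc ` pverts G \<subseteq> {..<k}" "ce ` uedges G \<subseteq> {..<k}"
    using assms(4) by (auto simp: total_colorable_def)
  let ?O = "{a \<in> parcs G. fst a = v}"
  have card: "card ?O = 3" using assms(2,3) by (simp add: cubic_def out_degree_def out_arcs_def)
  have edge: "{v, snd a} \<in> uedges G" if "a \<in> ?O" for a
    using that by (cases a) (auto simp: uedges_def)
  have "inj_on (\<lambda>a. ce {v, snd a}) ?O"
  proof (rule inj_onI, rule ccontr)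
    fix a b assume *: "a \<in> ?O" "b \<in> ?O" "ce {v, snd a} = ce {v, snd b}" "a \<noteq> b"
    then have "{v, snd a} \<noteq> {v, snd b}" by (auto simp: doubleton_eq_iff prod_eq_iff)
    then show False using c(1) edge[OF *(1)] edge[OF *(2)] *(3) by (auto simp: total_coloring_def)
  qed
  then have "card ((\<lambda>a. ce {v, snd a}) ` ?O) = 3" using card by (simp add: card_image)
  moreover have "vc v \<notin> (\<lambda>a. ce {v, snd a}) ` ?O"
    using c(1) edge by (auto simp: total_coloring_def)
  moreover have "finite ?O" using card by (intro card_ge_0_finite) simp
  ultimately have "4 = card (insert (vc v) ((\<lambda>a. ce {v, snd a}) ` ?O))" by simp
  also have "\<dots> \<le> k"
  proof -
    have "insert (vc v) ((\<lambda>a. ce {v, snd a}) ` ?O) \<subseteq> {..<k}" using c(2,3) assms(3) edge by blast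
    then have "card (insert (vc v) ((\<lambda>a. ce {v, snd a}) ` ?O)) \<le> card {..<k}"
      by (rule card_mono[OF finite_lessThan])
    then show ?thesis by simp
  qed
  finally show ?thesis by simp
qed

lemma cubic_max_degree:
  assumes "cubic G" "v \<in> pverts G"
  shows "max_degree G = 3"
proof -
  have "out_degree (with_proj G) ` pverts G = {3}" using assms by (auto simp: cubic_def image_iff)
  then show ?thesis by (simp add: max_degree_def)
qed

text \<open>
  The coordinates of the two halves run in opposite directions, so the three colors on the boundary
  of one half have to be reflected and not only shifted.
\<close>

definition perm3 :: "int \<Rightarrow> nat \<Rightarrow> nat" where
  "perm3 s x = (if x < 3 then nat ((s - int x) mod 3) else x)"

lemma perm3_inj: "perm3 s x = perm3 s y \<longleftrightarrow> x = y"
proof -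
  have "x = y" if "(s - int x) mod 3 = (s - int y) mod 3" "x < 3" "y < 3"
    using that by presburger
  moreover have "nat ((s - int z) mod 3) \<noteq> w" "w \<noteq> nat ((s - int z) mod 3)" if "\<not> w < 3" for z w
    using that nat_less_iff[of "(s - int z) mod 3" 3] by auto
  moreover have "nat ((s - int x) mod 3) = nat ((s - int y) mod 3) \<longleftrightarrow> (s - int x) mod 3 = (s - int y) mod 3"
    by (intro eq_nat_nat_iff) simp_all
  ultimately show ?thesis unfolding perm3_def by auto
qed

lemma perm3_less: "x < 4 \<Longrightarrow> perm3 s x < 4"
proof -
  have "nat ((s - int x) mod 3) < 3" by (simp add: nat_less_iff)
  then show "x < 4 \<Longrightarrow> perm3 s x < 4" by (simp add: perm3_def)
qed

text \<open>The quotient of a sum exceeds the sum of the quotients by the carry of the remainders,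
  which is \<open>0\<close> or \<open>1\<close>.\<close>

lemma outpos_add:
  assumes "1 \<le> i"
  shows "outpos i (t + e) - outpos i t - (2 * int e - int (e div i)) \<in> {-1, 0}"
proof -
  have "(t mod i + e mod i) div i \<le> 1"
  proof -
    have "t mod i < i" "e mod i < i" using assms by simp_all
    then have "t mod i + e mod i < 2 * i" by linarith
    then have "(t mod i + e mod i) div i < 2" by (simp add: less_mult_imp_div_less)
    then show ?thesis by linarith
  qed
  then show ?thesis unfolding outpos_def div_add1_eq[of t e i] by auto
qed

lemma reflect_interval: "(\<lambda>i. n + 1 - i) ` {1..n} = {1..(n :: nat)}"
proof
  show "{1..n} \<subseteq> (\<lambda>i. n + 1 - i) ` {1..n}"
  proof
    fix i assume "i \<in> {1..n}"
    then show "i \<in> (\<lambda>i. n + 1 - i) ` {1..n}" by (intro image_eqI[of _ _ "n + 1 - i"]) auto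
  qed
qed auto

section \<open>Exchange of the covers, and gluing along the central layer\<close>

context nanodisc begin

text \<open>The nanodisc seen from the other cover: layers and cycles are numbered backwards while
  the embedding stays fixed. It transfers \<open>rows\<close> to the second half.\<close>

lemma dual: "nanodisc r G R (\<lambda>f. 2 * r - L f) (\<lambda>i. C (2 * r + 1 - i))"
proof
  show "fullerene_embedding G R" "2 \<le> r" using fullerene radius by blast+
  have L_le: "L f \<le> 2 * r" if "f \<in> faces G R" for f
    using layering that by (simp add: nanodisc_layering_def)
  have sizes: "\<forall>i\<le>2 * r. card {f \<in> faces G R. L f = i} =
      (if i = 0 \<or> i = 2 * r then 1 else 6 * min i (2 * r - i))"
    using layering unfolding nanodisc_layering_def by (elim conjE) assumption
  let ?j = "\<lambda>i. 2 * r + 1 - i"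
  have "\<forall>i\<le>2 * r. card {f \<in> faces G R. 2 * r - L f = i} =
        (if i = 0 \<or> i = 2 * r then 1 else 6 * min i (2 * r - i))"
  proof (intro allI impI)
    fix i assume i: "i \<le> 2 * r"
    have "{f \<in> faces G R. 2 * r - L f = i} = {f \<in> faces G R. L f = 2 * r - i}"
      using L_le i by force
    then show "card {f \<in> faces G R. 2 * r - L f = i} =
        (if i = 0 \<or> i = 2 * r then 1 else 6 * min i (2 * r - i))"
      using sizes[rule_format, of "2 * r - i"] i by (auto simp: min.commute)
  qed
  moreover have "\<forall>f\<in>faces G R. 2 * r - L f \<le> 2 * r" by simp
  moreover have "\<forall>f\<in>faces G R. card f = 5 \<longrightarrow> 2 * r - L f = r"
    using layering by (simp add: nanodisc_layering_def)
  moreover have "\<forall>i\<in>{1..2 * r}. pre_digraph.cycle (with_proj G) (C (?j i)) \<and>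
        length (C (?j i)) = 12 * min i (?j i) - 6"
  proof
    fix i assume i: "i \<in> {1..2 * r}"
    then have j: "?j i \<in> {1..2 * r}" by auto
    have "2 * r + 1 - ?j i = i" using i by simp
    then have "length (C (?j i)) = 12 * min i (?j i) - 6"
      using len_C[OF j] by (simp add: len_def min.commute)
    with cycle_C[OF j] show "pre_digraph.cycle (with_proj G) (C (?j i)) \<and>
        length (C (?j i)) = 12 * min i (?j i) - 6" by blast
  qed
  moreover have "\<forall>i\<in>{1..2 * r}. \<forall>j\<in>{1..2 * r}. i \<noteq> j \<longrightarrow> cycle_verts (C (?j i)) \<inter> cycle_verts (C (?j j)) = {}"
  proof (intro ballI impI)
    fix i j assume ij: "i \<in> {1..2 * r}" "j \<in> {1..2 * r}" "i \<noteq> j"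
    then have "?j i \<in> {1..2 * r}" "?j j \<in> {1..2 * r}" "?j i \<noteq> ?j j" by auto
    then show "cycle_verts (C (?j i)) \<inter> cycle_verts (C (?j j)) = {}"
      using CV_disjoint unfolding CV_def by blast
  qed
  moreover have "(\<Union>i\<in>{1..2 * r}. cycle_verts (C (?j i))) = V"
  proof -
    have "?j ` {1..2 * r} = {1..2 * r}" by (rule reflect_interval)
    then show ?thesis using CV_Union unfolding CV_def by (metis image_image)
  qed
  moreover have "\<forall>i\<in>{1..2 * r}. \<forall>a\<in>A. a \<in> cycle_arcs (C (?j i)) \<longleftrightarrow>
        {2 * r - L (face_of R a), 2 * r - L (face_of R (prod.swap a))} = {i - 1, i}"
  proof (intro ballI)
    fix i a assume i: "i \<in> {1..2 * r}" and a: "a \<in> A"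
    have j: "?j i \<in> {1..2 * r}" using i by auto
    have "lay a \<le> 2 * r" "lay (prod.swap a) \<le> 2 * r" using a lay_le arc_sym by (cases a; auto)+
    then show "a \<in> cycle_arcs (C (?j i)) \<longleftrightarrow>
        {2 * r - L (face_of R a), 2 * r - L (face_of R (prod.swap a))} = {i - 1, i}"
      unfolding cycle_arc_iff[OF j a] lay_def using i by (auto simp: doubleton_eq_iff)
  qed
  moreover have "\<forall>(u, v)\<in>A - (\<Union>i\<in>{1..2 * r}. cycle_arcs (C (?j i))). \<exists>i\<in>{1..<2 * r}.
        u \<in> cycle_verts (C (?j i)) \<and> v \<in> cycle_verts (C (?j (i + 1))) \<or>
        v \<in> cycle_verts (C (?j i)) \<and> u \<in> cycle_verts (C (?j (i + 1)))"
  proof (intro ballI, clarify)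
    fix u v assume "(u, v) \<in> A" "(u, v) \<notin> (\<Union>i\<in>{1..2 * r}. cycle_arcs (C (?j i)))"
    moreover note reflect_interval[of "2 * r"]
    ultimately have "(u, v) \<in> A - CA" unfolding CA_def by (metis DiffI image_image)
    from radial[OF this] obtain i where i: "i \<in> {1..<2 * r}"
      "u \<in> CV i \<and> v \<in> CV (i + 1) \<or> v \<in> CV i \<and> u \<in> CV (i + 1)" by blast
    have "?j (2 * r - i) = i + 1" "?j (2 * r - i + 1) = i" "2 * r - i \<in> {1..<2 * r}" using i(1) by auto
    then show "\<exists>i\<in>{1..<2 * r}. u \<in> cycle_verts (C (?j i)) \<and> v \<in> cycle_verts (C (?j (i + 1))) \<or>
        v \<in> cycle_verts (C (?j i)) \<and> u \<in> cycle_verts (C (?j (i + 1)))"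
      using i(2) unfolding CV_def by (intro bexI[of _ "2 * r - i"]) auto
  qed
  ultimately show "nanodisc_layering r G R (\<lambda>f. 2 * r - L f) (\<lambda>i. C (?j i))"
    unfolding nanodisc_layering_def by (intro conjI) assumption+
qed

text \<open>Exchanging inside and outside reverses the normalized direction, so in the original
  numbering these enumerations run opposite to \<open>oriented\<close> ones.\<close>

lemma dual_rows:
  "\<exists>v. \<forall>i\<in>{1..r}. enum (2 * r + 1 - i) (v i) \<and>
     (\<forall>n. lay (v i n, v i (n + 1)) = 2 * r - i \<and> lay (v i (n + 1), v i n) = 2 * r + 1 - i) \<and>
     (\<forall>n. rad (v i n) \<in> CV (2 * r - i) \<longleftrightarrow> even (n mod (2 * int i - 1))) \<and>
     (i < r \<longrightarrow> (\<forall>n. even (n mod (2 * int i - 1)) \<longrightarrow> rad (v i n) = v (i + 1) (outward i n)))"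
proof -
  interpret D: nanodisc r G R "\<lambda>f. 2 * r - L f" "\<lambda>i. C (2 * r + 1 - i)" by (rule dual)
  have CA: "D.CA = CA"
  proof -
    have "(\<lambda>i. 2 * r + 1 - i) ` {1..2 * r} = {1..2 * r}" by (rule reflect_interval)
    then show ?thesis unfolding D.CA_def CA_def by (metis image_image)
  qed
  have rad_eq: "D.rad = rad" by (intro ext) (simp only: D.rad_def rad_def CA)
  have CV_eq: "D.CV i = CV (2 * r + 1 - i)" for i by (simp only: D.CV_def CV_def)
  have lay_eq: "D.lay a = 2 * r - lay a" for a by (simp only: D.lay_def lay_def)
  have len_eq: "i \<in> {1..r} \<Longrightarrow> len (2 * r + 1 - i) = len i" for i by (simp add: len_def min.commute)
  obtain v where v: "\<And>i. i \<in> {1..r} \<Longrightarrow> D.row i (v i)"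
    "\<And>i n. i \<in> {1..r} \<Longrightarrow> i < r \<Longrightarrow> even (n mod (2 * int i - 1)) \<Longrightarrow> D.rad (v i n) = v (i + 1) (outward i n)"
    using D.rows by blast
  show ?thesis
  proof (intro exI[of _ v] ballI conjI allI impI)
    fix i assume i: "i \<in> {1..r}"
    then have i2: "i \<in> {1..2 * r}" by auto
    note ov = D.rowD(1)[OF v(1)[OF i]]
    show en: "enum (2 * r + 1 - i) (v i)"
      using D.orientedD(1)[OF ov] unfolding enum_def D.enum_def CV_eq len_eq[OF i] .
    fix n
    have "2 * r + 1 - i \<in> {1..2 * r}" using i by auto
    note arcs = enum_arc[OF this en, of n]
    have "2 * r - lay (v i n, v i (n + 1)) = i" "2 * r - lay (v i (n + 1), v i n) = i - 1"
      using D.orientedD(2,3)[OF ov, of n] unfolding lay_eq by blast+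
    then show "lay (v i n, v i (n + 1)) = 2 * r - i" "lay (v i (n + 1), v i n) = 2 * r + 1 - i"
      using lay_le[OF arcs(1)] lay_le[OF arcs(2)] i by auto
    show "rad (v i n) \<in> CV (2 * r - i) \<longleftrightarrow> even (n mod (2 * int i - 1))"
      using D.rowD(2)[OF v(1)[OF i], of n] unfolding CV_eq rad_eq by simp
    assume "i < r" "even (n mod (2 * int i - 1))"
    then show "rad (v i n) = v (i + 1) (outward i n)"
      using v(2)[OF i, of n] unfolding rad_eq by blast
  qed
qed

text \<open>Central faces may be pentagons, so gap lengths are not controlled, but each face still
  leads from one radial edge to the next on both cycles. The indices advance together, and only the
  twist \<open>e\<close> is left.\<close>

lemma central_ring:
  assumes c: "row r c" and d: "oriented (r + 1) d"
    and X: "\<And>n. rad (d n) \<in> CV r \<longleftrightarrow> even (n mod (2 * int r - 1))"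
  shows "\<exists>e. \<forall>t. rad (c (outpos r t)) = d (outpos r (t + e))"
proof -
  have r: "1 \<le> r" "r < 2 * r" "r \<in> {1..2 * r}" "r + 1 \<in> {1..2 * r}" using radius by auto
  note oc = rowD(1)[OF c]
  have len: "0 < len (r + 1)" using len_pos[OF r(4)] by simp
  have "rad (c 0) \<in> CV (r + 1)" using rowD(2)[OF c, of 0] by simp
  then have "rad (c 0) \<in> range d" using orientedD(1)[OF d] by (simp add: enum_def)
  then obtain m where "rad (c 0) = d m" by blast
  moreover have "d m = d (m mod len (r + 1))" by (simp add: enum_eq_iff[OF r(4) orientedD(1)[OF d]])
  ultimately have m: "rad (c 0) = d (m mod len (r + 1))" by simp
  have "c 0 \<in> CV r" "c 0 \<in> V" using enum_CV[OF r(3) orientedD(1)[OF oc]] enum_V[OF r(3) orientedD(1)[OF oc]] by auto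
  then have "even (m mod len (r + 1) mod (2 * int r - 1))" using X m rad_rad by metis
  then obtain e where e: "m mod len (r + 1) = outpos r e"
    using outpos_surj[OF r(1), of "m mod len (r + 1)"] len by auto
  have "rad (c (outpos r t)) = d (outpos r (t + e))" for t
  proof (induction t)
    case 0
    then show ?case using m e by (simp add: outpos_def)
  next
    case (Suc t)
    from ring[OF r(1,2) oc d Suc] obtain g h where
      gh: "(g, h) \<in> {(1, 2), (1, 3), (2, 1), (2, 2), (3, 1)}"
      "rad (c (outpos r t + g)) = d (outpos r (t + e) + h)"
      "\<And>s. 1 \<le> s \<Longrightarrow> s < g \<Longrightarrow> rad (c (outpos r t + s)) \<notin> CV (r + 1)"
      "\<And>s. 1 \<le> s \<Longrightarrow> s < h \<Longrightarrow> rad (d (outpos r (t + e) + s)) \<notin> CV r"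
      by metis
    have dV: "d x \<in> CV (r + 1)" and cV: "c x \<in> CV r" "c x \<in> V" for x
      using enum_CV[OF r(4) orientedD(1)[OF d]] enum_CV[OF r(3) orientedD(1)[OF oc]]
        enum_V[OF r(3) orientedD(1)[OF oc]] by auto
    have "rad (d (outpos r (t + e) + h)) = c (outpos r t + g)"
      using gh(2) rad_rad[OF cV(2), of "outpos r t + g"] by simp
    then have "rad (d (outpos r (t + e) + h)) \<in> CV r" using cV by simp
    then have "outpos r (Suc (t + e)) = outpos r (t + e) + h"
      using gh by (intro outpos_gap(2)[OF r(1) X]) auto
    moreover have "rad (c (outpos r t + g)) \<in> CV (r + 1)" using gh(2) dV by simp
    then have "outpos r (Suc t) = outpos r t + g"
      using gh by (intro outpos_gap(2)[OF r(1) rowD(2)[OF c]]) auto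
    ultimately show ?case using gh(2) by simp
  qed
  then show ?thesis by blast
qed

lemma two_halves:
  obtains U :: "bool \<Rightarrow> nat \<Rightarrow> int \<Rightarrow> 'a" and s :: int and e :: nat where
    "\<And>h i. i \<in> {1..r} \<Longrightarrow> enum (if h then 2 * r + 1 - i else i) (U h i)"
    "\<And>h i n. i \<in> {1..r} \<Longrightarrow>
       rad (U h i n) \<in> CV (if h then 2 * r - i else i + 1) \<longleftrightarrow> even (n mod (2 * int i - 1))"
    "\<And>h i n. i \<in> {1..<r} \<Longrightarrow> even (n mod (2 * int i - 1)) \<Longrightarrow> rad (U h i n) = U h (i + 1) (outward i n)"
    "\<And>t. rad (U False r (outpos r t)) = U True r (s - outpos r (t + e))"
proof -
  obtain u where u: "\<And>i. i \<in> {1..r} \<Longrightarrow> row i (u i)"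
    "\<And>i n. i \<in> {1..r} \<Longrightarrow> i < r \<Longrightarrow> even (n mod (2 * int i - 1)) \<Longrightarrow> rad (u i n) = u (i + 1) (outward i n)"
    using rows by blast
  obtain v where v: "\<And>i. i \<in> {1..r} \<Longrightarrow> enum (2 * r + 1 - i) (v i)"
    "\<And>i n. i \<in> {1..r} \<Longrightarrow> lay (v i n, v i (n + 1)) = 2 * r - i"
    "\<And>i n. i \<in> {1..r} \<Longrightarrow> lay (v i (n + 1), v i n) = 2 * r + 1 - i"
    "\<And>i n. i \<in> {1..r} \<Longrightarrow> rad (v i n) \<in> CV (2 * r - i) \<longleftrightarrow> even (n mod (2 * int i - 1))"
    "\<And>i n. i \<in> {1..r} \<Longrightarrow> i < r \<Longrightarrow> even (n mod (2 * int i - 1)) \<Longrightarrow> rad (v i n) = v (i + 1) (outward i n)"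
    using dual_rows by blast
  have r: "r \<in> {1..r}" "r + 1 \<in> {1..2 * r}" "2 * r + 1 - r = r + 1" "2 * r - r = r" using radius by auto
  \<comment> \<open>The last offset of a sector: \<open>n \<mapsto> s - n\<close> maps sectors to
    sectors and, \<open>s\<close> being even, preserves the parity of offsets.\<close>
  define s where "s = 2 * int r - 2"
  define d where "d n = v r (s - n)" for n
  have "enum (r + 1) d" unfolding d_def using enum_reflect[OF r(2)] v(1)[OF r(1)] r(3) by simp
  moreover have "lay (d n, d (n + 1)) = r + 1" "lay (d (n + 1), d n) = r" for n
    using v(2,3)[OF r(1), of "s - (n + 1)"] r(3,4) by (simp_all add: d_def)
  ultimately have d: "oriented (r + 1) d" by (simp add: oriented_def)
  have X: "rad (d n) \<in> CV r \<longleftrightarrow> even (n mod (2 * int r - 1))" for n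
  proof -
    let ?L = "2 * int r - 1"
    have L: "0 < ?L" using radius by simp
    have "(s - n) mod ?L = (s - n mod ?L) mod ?L" by (simp add: mod_diff_right_eq)
    also have "\<dots> = s - n mod ?L"
      using pos_mod_bound[OF L, of n] pos_mod_sign[OF L, of n] by (intro mod_pos_pos_trivial) (auto simp: s_def)
    finally have "even ((s - n) mod ?L) \<longleftrightarrow> even (n mod ?L)" by (simp add: s_def)
    then show ?thesis using v(4)[OF r(1), of "s - n"] r(4) by (simp add: d_def)
  qed
  obtain e where "\<And>t. rad (u r (outpos r t)) = d (outpos r (t + e))"
    using central_ring[OF u(1)[OF r(1)] d X] by blast
  then show ?thesis
    using u v rowD orientedD(1) by (intro that[of "\<lambda>h. if h then v else u" s e]) (auto simp: d_def)
qed

section \<open>The coloring of the whole nanodisc\<close>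

lemma total_colorable_4:
  assumes r: "r mod 3 = 2" "5 \<le> r"
  shows "total_colorable G 4"
proof -
  obtain U :: "bool \<Rightarrow> nat \<Rightarrow> int \<Rightarrow> 'a" and s e where
    enum_U: "\<And>h i. i \<in> {1..r} \<Longrightarrow> enum (if h then 2 * r + 1 - i else i) (U h i)" and
    out_U: "\<And>h i n. i \<in> {1..r} \<Longrightarrow>
       rad (U h i n) \<in> CV (if h then 2 * r - i else i + 1) \<longleftrightarrow> even (n mod (2 * int i - 1))" and
    rad_U: "\<And>h i n. i \<in> {1..<r} \<Longrightarrow> even (n mod (2 * int i - 1)) \<Longrightarrow> rad (U h i n) = U h (i + 1) (outward i n)" and
    mid_U: "\<And>t. rad (U False r (outpos r t)) = U True r (s - outpos r (t + e))"
    by (rule two_halves) (rule that; assumption)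
  define idx where "idx h i = (if h then 2 * r + 1 - i else i)" for h and i :: nat
  have idx: "idx h i \<in> {1..2 * r}" "len (idx h i) = 6 * (2 * int i - 1)" if "i \<in> {1..r}" for h i
    using that by (auto simp: idx_def len_def min_def)
  have en: "enum (idx h i) (U h i)" if "i \<in> {1..r}" for h i
    using enum_U[OF that, of h] by (simp add: idx_def)
  have U_CV: "U h i n \<in> CV (idx h i)" and U_V: "U h i n \<in> V" if "i \<in> {1..r}" for h i n
    using enum_CV[OF idx(1)[OF that] en[OF that]] enum_V[OF idx(1)[OF that] en[OF that]] by auto
  have U_eq: "U h i x = U h i y \<longleftrightarrow> x mod (6 * (2 * int i - 1)) = y mod (6 * (2 * int i - 1))"
    if "i \<in> {1..r}" for h i x y
    using enum_eq_iff[OF idx(1)[OF that] en[OF that]] idx(2)[OF that] by simp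
  have CV_U: "\<exists>n. x = U h i n" if "x \<in> CV (idx h i)" "i \<in> {1..r}" for h i x
  proof -
    have "x \<in> range (U h i)" using that(1) en[OF that(2), of h] by (simp add: enum_def)
    then show ?thesis by blast
  qed
  have uniq: "h = h' \<and> i = i'" if "i \<in> {1..r}" "i' \<in> {1..r}" "U h i n = U h' i' n'" for h h' i i' n n'
  proof -
    have "U h i n \<in> CV (idx h' i')" using that(3) U_CV[OF that(2)] by simp
    then have "idx h i = idx h' i'"
      by (rule CV_disjoint[OF idx(1)[OF that(1)] idx(1)[OF that(2)] U_CV[OF that(1)]])
    then show ?thesis using that(1,2) by (auto simp: idx_def split: if_splits)
  qed
  have cover: "\<exists>h i n. i \<in> {1..r} \<and> x = U h i n" if "x \<in> V" for x
  proof -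
    have "x \<in> (\<Union>m\<in>{1..2 * r}. CV m)" unfolding CV_Union by (rule that)
    then obtain m where m: "m \<in> {1..2 * r}" "x \<in> CV m" by (rule UN_E)
    have "\<exists>h i. i \<in> {1..r} \<and> idx h i = m"
    proof (cases "m \<le> r")
      case True
      then show ?thesis using m(1) by (intro exI[of _ False] exI[of _ m]) (simp add: idx_def)
    next
      case False
      then show ?thesis using m(1) by (intro exI[of _ True] exI[of _ "2 * r + 1 - m"]) (auto simp: idx_def)
    qed
    then obtain h i where hi: "i \<in> {1..r}" "idx h i = m" by blast
    then obtain n where "x = U h i n" using CV_U[of x h i] m(2) by auto
    then show ?thesis using hi(1) by blast
  qed
  \<comment> \<open>A vertex determines \<open>h\<close> and \<open>i\<close> uniquely and
    \<open>n\<close> up to periodicity, so a function of the coordinates that respects this descends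
    to vertices.\<close>
  have lift: "\<exists>f. \<forall>h i n. i \<in> {1..r} \<longrightarrow> f (U h i n) = F h i n"
    if per: "\<And>h i n n'. i \<in> {1..r} \<Longrightarrow> U h i n = U h i n' \<Longrightarrow> F h i n = F h i n'"
    for F :: "bool \<Rightarrow> nat \<Rightarrow> int \<Rightarrow> 'b"
  proof -
    define f where "f x = (THE y. \<exists>h i n. i \<in> {1..r} \<and> x = U h i n \<and> y = F h i n)" for x
    have "f (U h i n) = F h i n" if "i \<in> {1..r}" for h i n
      unfolding f_def
    proof (rule the_equality)
      show "\<exists>h' i' n'. i' \<in> {1..r} \<and> U h i n = U h' i' n' \<and> F h i n = F h' i' n'" using that by blast
      fix y assume "\<exists>h' i' n'. i' \<in> {1..r} \<and> U h i n = U h' i' n' \<and> y = F h' i' n'"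
      then obtain h' i' n' where *: "i' \<in> {1..r}" "U h i n = U h' i' n'" "y = F h' i' n'" by blast
      have "h' = h" "i' = i" using uniq[OF that *(1,2)] by simp_all
      then show "y = F h i n" using per[OF that, of h n n'] *(2,3) by simp
    qed
    then show ?thesis by blast
  qed
  have per_shift: "U h i (n + k) = U h i (n' + k)" if "i \<in> {1..r}" "U h i n = U h i n'" for h i n n' k
    using that(2) unfolding U_eq[OF that(1)] by (rule mod_add_cong) simp
  \<comment> \<open>makes the positions on \<open>C r\<close> and \<open>C (r + 1)\<close> joined by a radial edge differ by \<open>1\<close> or \<open>2\<close> modulo \<open>3\<close>\<close>
  define z where "z = 2 - (2 * int e - int (e div r)) + s"
  define p where "p h x = (if h then perm3 z x else x)" for h x
  have p_eq: "p h x = p h y \<longleftrightarrow> x = y" for h x y by (simp add: p_def perm3_inj)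
  have p_less: "x < 4 \<Longrightarrow> p h x < 4" for h x by (simp add: p_def perm3_less)
  have per_half: "half_vcol r i n = half_vcol r i n' \<and> half_ecol r i n = half_ecol r i n' \<and> half_rcol r i n = half_rcol r i n'"
    if "i \<in> {1..r}" "U h i n = U h i n'" for h i n n'
    using half_periodic[of i n n' r] that U_eq[OF that(1)] by auto
  have "\<exists>f. \<forall>h i n. i \<in> {1..r} \<longrightarrow> f (U h i n) = p h (half_vcol r i n)"
    by (rule lift) (drule (1) per_half, simp)
  then obtain vc where vc: "\<And>h i n. i \<in> {1..r} \<Longrightarrow> vc (U h i n) = p h (half_vcol r i n)" by blast
  have "\<exists>f. \<forall>h i n. i \<in> {1..r} \<longrightarrow> f (U h i n) = p h (half_ecol r i n)"
    by (rule lift) (drule (1) per_half, simp)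
  then obtain fc where fc: "\<And>h i n. i \<in> {1..r} \<Longrightarrow> fc (U h i n) = p h (half_ecol r i n)" by blast
  have "\<exists>f. \<forall>h i n. i \<in> {1..r} \<longrightarrow> f (U h i n) = p h (half_rcol r i n)"
    by (rule lift) (drule (1) per_half, simp)
  then obtain rc where rc: "\<And>h i n. i \<in> {1..r} \<Longrightarrow> rc (U h i n) = p h (half_rcol r i n)" by blast
  have "\<exists>f. \<forall>h i n. i \<in> {1..r} \<longrightarrow> f (U h i n) = U h i (n + 1)"
    by (rule lift) (rule per_shift)
  then obtain S where S: "\<And>h i n. i \<in> {1..r} \<Longrightarrow> S (U h i n) = U h i (n + 1)" by blast
  have "\<exists>f. \<forall>h i n. i \<in> {1..r} \<longrightarrow> f (U h i n) = U h i (n + - 1)"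
    by (rule lift) (rule per_shift)
  then obtain P where P: "\<And>h i n. i \<in> {1..r} \<Longrightarrow> P (U h i n) = U h i (n + - 1)" by blast

  \<comment> \<open>These conditions are symmetric in the two ends of a radial edge, so one end
    suffices: the one from which it leads outwards, or for a central edge the one in the half
    \<open>False\<close>.\<close>
  define good where "good x \<longleftrightarrow> vc x \<noteq> vc (rad x) \<and> rc x = rc (rad x)" for x
  have good_rad: "good x" if "good (rad x)" "x \<in> V" for x
    using that rad_rad[OF that(2)] by (auto simp: good_def)
  have good_out: "good (U h i n)" if "i \<in> {1..<r}" "even (n mod (2 * int i - 1))" for h i n
  proof -
    have i: "1 \<le> i" "i < r" "i \<in> {1..r}" "i + 1 \<in> {1..r}" using that(1) by auto
    show ?thesis
      unfolding good_def rad_U[OF that] vc[OF i(3)] vc[OF i(4)] rc[OF i(3)] rc[OF i(4)] p_eq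
      using half_radial[OF r i(1,2) that(2)] by blast
  qed
  have r_in: "r \<in> {1..r}" "1 \<le> r" using r by auto
  have good_mid: "good (U False r n)" if "even (n mod (2 * int r - 1))" for n
  proof -
    let ?N = "6 * (2 * int r - 1)"
    have dvd: "2 * int r - 1 dvd ?N" by (rule dvd_triv_right)
    have N: "0 < ?N" using r by simp
    have "even (n mod ?N mod (2 * int r - 1))" using that mod_mod_cancel[OF dvd] by simp
    then obtain t where t: "n mod ?N = outpos r t" using outpos_surj[OF r_in(2), of "n mod ?N"] N by auto
    let ?m = "outpos r t" and ?m' = "outpos r (t + e)"
    have n: "U False r n = U False r ?m" unfolding U_eq[OF r_in(1)] t[symmetric] by simp
    have "perm3 z (nat ((s - ?m') mod 3)) = nat ((z - (s - ?m')) mod 3)"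
      by (simp add: perm3_def nat_less_iff mod_diff_right_eq)
    moreover have "?m mod 3 \<noteq> (z - (s - ?m')) mod 3"
    proof -
      \<comment> \<open>The carry in \<open>outpos_add\<close> contributes \<open>-1\<close> or
        \<open>0\<close>; the constant \<open>2\<close> in \<open>z\<close> keeps the sum away from
        multiples of three.\<close>
      have "z - (s - ?m') - ?m \<in> {1, 2}" using outpos_add[OF r_in(2), of t e] by (auto simp: z_def)
      then show ?thesis by (auto simp: mod_eq_dvd_iff) presburger+
    qed
    ultimately have "p False (half_vcol r r ?m) \<noteq> p True (half_vcol r r (s - ?m'))"
      by (simp add: p_def half_vcol_def eq_nat_nat_iff)
    moreover have "p False (half_rcol r r ?m) = p True (half_rcol r r (s - ?m'))"
      by (simp add: p_def half_rcol_def perm3_def)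
    ultimately show ?thesis
      unfolding n good_def mid_U vc[OF r_in(1)] rc[OF r_in(1)] by blast
  qed
  have good: "good x" if "x \<in> V" for x
  proof -
    obtain h i n where i: "i \<in> {1..r}" and x: "x = U h i n" using cover[OF \<open>x \<in> V\<close>] by blast
    \<comment> \<open>If the radial edge leads outwards from \<open>rad x\<close> to
      \<open>x\<close>, then \<open>rad x\<close> has an even offset, and \<open>good\<close> is
      obtained there first.\<close>
    have inward: "even (n' mod (2 * int i' - 1))"
      if "i' \<in> {1..r}" "rad x = U h' i' n'" "x \<in> CV (if h' then 2 * r - i' else i' + 1)" for h' i' n'
      using out_U[OF that(1), of h' n'] that(2,3) rad_rad[OF \<open>x \<in> V\<close>] by simp
    show ?thesis
    proof (cases "even (n mod (2 * int i - 1))")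
      case True
      show ?thesis
      proof (cases "i = r")
        case False
        then show ?thesis using good_out[of i n h] True i x by simp
      next
        case ir: True
        show ?thesis
        proof (cases h)
          case False
          then show ?thesis using good_mid True ir x by simp
        next
          case h: True
          have "rad x \<in> CV (idx False r)" using out_U[OF i, of h n] True ir h x by (simp add: idx_def)
          then obtain n' where n': "rad x = U False r n'" using CV_U[OF _ r_in(1)] by blast
          have "x \<in> CV (r + 1)" using U_CV[OF i, of h n] x ir h by (simp add: idx_def)
          then have "even (n' mod (2 * int r - 1))" using inward[OF r_in(1) n'] by simp
          then show ?thesis using good_mid[of n'] n' good_rad[OF _ that] by simp
        qed
      qed
    next
      case False
      have "i \<noteq> 1" using False by (intro notI) simp
      then have i1: "i - 1 \<in> {1..r}" "i - 1 \<in> {1..<r}" using i by auto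
      have "rad x \<notin> CV (if h then 2 * r - i else i + 1)" using out_U[OF i, of h n] False x by simp
      then have "rad x \<in> CV (idx h (i - 1))"
        using rad_CV[OF U_CV[OF i, of h n] idx(1)[OF i, of h]] x i i1 by (cases h) (auto simp: idx_def Suc_diff_le)
      then obtain n' where n': "rad x = U h (i - 1) n'" using CV_U[OF _ i1(1)] by blast
      have "idx h i = (if h then 2 * r - (i - 1) else (i - 1) + 1)" using i i1 by (auto simp: idx_def)
      then have "even (n' mod (2 * int (i - 1) - 1))"
        using inward[OF i1(1) n'] U_CV[OF i, of h n] x by simp
      then show ?thesis using good_out[OF i1(2), of n' h] n' good_rad[OF _ that] by simp
    qed
  qed

  \<comment> \<open>The color of a cycle edge is stored by \<open>fc\<close> at its first vertex in
    the enumeration; by \<open>star\<close> the three alternatives are exclusive and cover all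
    neighbors.\<close>
  define ec where "ec x y = (if y = S x then fc x else if y = P x then fc y else rc x)" for x y
  have star: "S x \<in> V \<and> P x \<in> V \<and> P (S x) = x \<and> S (P x) = x \<and> S x \<noteq> P x \<and> rad x \<noteq> S x \<and> rad x \<noteq> P x \<and>
      (\<forall>y. (x, y) \<in> A \<longrightarrow> y = S x \<or> y = P x \<or> y = rad x) \<and>
      distinct [vc x, fc x, fc (P x), rc x] \<and> vc x \<noteq> vc (S x) \<and> vc x < 4 \<and> fc x < 4 \<and> rc x < 4"
    if "x \<in> V" for x
  proof -
    obtain h i n where i: "i \<in> {1..r}" and x: "x = U h i n" using cover[OF \<open>x \<in> V\<close>] by blast
    have i': "1 \<le> i" using i by simp
    have Sx: "S x = U h i (n + 1)" and Px: "P x = U h i (n - 1)" using S[OF i] P[OF i] x by simp_all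
    note E = idx(1)[OF i, of h] en[OF i, of h]
    have "P (S x) = x" "S (P x) = x" unfolding Sx Px S[OF i] P[OF i] x by simp_all
    moreover have "S x \<noteq> P x" unfolding Sx Px by (rule enum_neq[OF E])
    moreover have ra: "(x, rad x) \<in> A - CA" using rad_arc(1)[OF that] .
    then have "rad x \<noteq> S x" "rad x \<noteq> P x" using CA_from[OF E, of n "rad x"] x Sx Px by auto
    moreover have "y = S x \<or> y = P x \<or> y = rad x" if "(x, y) \<in> A" for y
      using that CA_from[OF E, of n y] rad_iff[OF \<open>x \<in> V\<close>, of y] Sx Px x by auto
    moreover have "distinct [vc x, fc x, fc (P x), rc x]"
      unfolding Px unfolding x vc[OF i] fc[OF i] rc[OF i] using half_vertex[OF i', of r n] by (simp add: p_eq)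
    moreover have "vc x \<noteq> vc (S x)"
      unfolding Sx unfolding x vc[OF i] p_eq by (rule half_cycle[OF i'])
    moreover have "vc x < 4" "fc x < 4" "rc x < 4"
      unfolding x vc[OF i] fc[OF i] rc[OF i] using half_bounds[OF i', of r n] p_less by blast+
    moreover have "S x \<in> V" "P x \<in> V" unfolding Sx Px by (rule U_V[OF i])+
    ultimately show ?thesis by blast
  qed
  have ec_S: "ec x (S x) = fc x" and ec_P: "ec x (P x) = fc (P x)" and ec_rad: "ec x (rad x) = rc x"
    if "x \<in> V" for x
    using star[OF that] by (auto simp: ec_def)
  show ?thesis
  proof (rule total_colorable_of_arc_coloring[where vc = vc and ec = ec])
    fix x y assume xy: "(x, y) \<in> A"
    then have V: "x \<in> V" "y \<in> V" using arc_verts by blast+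
    note lx = star[OF V(1)]
    consider "y = S x" | "y = P x" | "y = rad x" using lx xy by blast
    then have cases: "ec x y = ec y x \<and> vc x \<noteq> vc y \<and> vc x \<noteq> ec x y \<and> ec x y < 4"
    proof cases
      case 1
      have "ec y x = fc x" using ec_P[OF V(2)] lx 1 by simp
      then show ?thesis using lx 1 ec_S[OF V(1)] by simp
    next
      case 2
      have "ec y x = fc y" using ec_S[OF V(2)] lx 2 by simp
      then show ?thesis using lx 2 ec_P[OF V(1)] star[OF V(2)] by auto
    next
      case 3
      have "ec y x = rc x" using ec_rad[OF V(2)] rad_rad[OF V(1)] 3 good[OF V(1)] by (simp add: good_def)
      then show ?thesis using lx 3 ec_rad[OF V(1)] good[OF V(1)] by (simp add: good_def)
    qed
    show "(y, x) \<in> A \<and> ec x y = ec y x" using cases arc_sym[OF xy] by blast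
    show "vc x \<noteq> vc y \<and> vc x \<noteq> ec x y \<and> ec x y < 4" using cases by blast
    fix w assume "(x, w) \<in> A" "y \<noteq> w"
    then have "y = S x \<or> y = P x \<or> y = rad x" "w = S x \<or> w = P x \<or> w = rad x" using lx xy by blast+
    then show "ec x y \<noteq> ec x w"
      using lx ec_S[OF V(1)] ec_P[OF V(1)] ec_rad[OF V(1)] \<open>y \<noteq> w\<close> by auto
  qed (use star in blast)
qed

lemma V_nonempty: "V \<noteq> {}"
proof -
  have 1: "1 \<in> {1..2 * r}" using radius by simp
  obtain c where "enum 1 c" using ex_enum[OF 1] by blast
  then show ?thesis using enum_V[OF 1] by blast
qed

end

theorem theorem3:
  fixes G :: "'a pair_pre_digraph" and k r :: nat
  assumes "r = 5 + 3 * k"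
    and "fullerene_nanodisc r G"
  shows "type_1 G \<and> max_degree G + 1 = 4 \<and> total_chromatic_number G = 4"
proof -
  obtain R L C where disc: "2 \<le> r" "fullerene_embedding G R" "nanodisc_layering r G R L C"
    using assms(2) by (auto simp: fullerene_nanodisc_def)
  interpret nanodisc r G R L C by unfold_locales (fact disc)+
  have "r mod 3 = 2" "5 \<le> r" using assms(1) by presburger+
  then have four: "total_colorable G 4" by (rule total_colorable_4)
  obtain v where v: "v \<in> V" using V_nonempty by blast
  have cubic: "cubic G" using fullerene by (simp add: fullerene_embedding_def)
  have "total_chromatic_number G = 4"
    unfolding total_chromatic_number_def
    by (rule Least_equality[where P = "total_colorable G", OF four total_colorable_lower_bound[OF pair_graph cubic v]])
  moreover have "max_degree G = 3" by (rule cubic_max_degree[OF cubic v])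
  ultimately show ?thesis by (simp add: type_1_def)
qed

end
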